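(* Let $H$ be a separable complex Hilbert space, let $T$ be a densely defined closed symmetric operator in $H$ with equal deficiency indices, and let $(G,\Gamma_0,\Gamma_1)$ be a boundary triplet for $T$ such that the self-adjoint extension $T^*|_{\Gamma_0^{-1}(0)}$ has compact resolvent. For a unitary operator $U$ on $G$, let $T_U$ be the self-adjoint extension of $T$ given by restricting $T^*$ to $$D(T_U)=\{x\in D(T^* )\mid (Id-U)\Gamma_1x=\mathfrak{i}(Id+U)\Gamma_0x\}.$$ Then $U\mapsto T_U$ parameterizes all self-adjoint extensions of $T$ with compact resolvent by the unitary operators $U$ on $G$ such that $U-Id$ is compact; that is, $T_U$ has compact resolvent if and only if $U-Id$ is a compact operator on $G$.
   Context: $\mathfrak{i}$ is the imaginary unit; inner products are linear in the first variable. Equal deficiency indices means $\dim\ker(T^*-\mathfrak{i})=\dim\ker(T^*+\mathfrak{i})\in\mathbb{N}\cup\{\infty\}$. A boundary triplet for $T$ is a triple $(G,\Gamma_0,\Gamma_1)$ consisting of a Hilbert space $G$ and two linear maps $\Gamma_0,\Gamma_1:D(T^* )\to G$ such that (1) $(\Gamma_0,\Gamma_1):D(T^* )\to G\times G$ is surjective, and (2) for all $x,y\in D(T^* )$, $$(T^*x,y)_H-(x,T^*y)_H=(\Gamma_1x,\Gamma_0y)_G-(\Gamma_0x,\Gamma_1y)_G.$$ $\Gamma_0^{-1}(0)=\ker\Gamma_0\subseteq D(T^* )$. A self-adjoint extension of $T$ is a self-adjoint operator $\tilde T$ with $T\subseteq\tilde T\subseteq T^*$; it has compact resolvent if $(\tilde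 T-\mathfrak{i})^{-1}$ is compact on $H$. It is a known background fact that, for any boundary triplet, $U\mapsto T_U$ is a bijection from the set of all unitary operators on $G$ onto the set of all self-adjoint extensions of $T$ (with $U=Id$ corresponding to $T^*|_{\Gamma_0^{-1}(0)}$). $Id$ is the identity operator on $G$. *)

theory Defs
  imports "HOL-Analysis.Analysis"
begin

subsection \<open>Complex Hilbert spaces\<close>

class complex_vector = real_vector +
  fixes scaleC :: "complex \<Rightarrow> 'a \<Rightarrow> 'a" (infixr \<open>*\<^sub>C\<close> 75)
  assumes scaleC_add_right: "c *\<^sub>C (x + y) = c *\<^sub>C x + c *\<^sub>C y"
    and scaleC_add_left: "(c + d) *\<^sub>C x = c *\<^sub>C x + d *\<^sub>C x"
    and scaleC_scaleC: "c *\<^sub>C d *\<^sub>C x = (c * d) *\<^sub>C x"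
    and scaleC_one: "1 *\<^sub>C x = x"
    and scaleR_scaleC: "r *\<^sub>R x = complex_of_real r *\<^sub>C x"

global_interpretation complex_vector:
  vector_space "scaleC :: complex \<Rightarrow> 'a \<Rightarrow> 'a::complex_vector"
  by unfold_locales
    (simp_all add: scaleC_add_right scaleC_add_left scaleC_scaleC scaleC_one)

text \<open>
  The complex inner product is linear in the first argument. The real inner product of the
  superclass, and with it the norm and the topology, is determined by it as its real part;
  positive definiteness is inherited from \<^class>\<open>real_inner\<close>.
\<close>

class complex_inner = complex_vector + real_inner +
  fixes cinner :: "'a \<Rightarrow> 'a \<Rightarrow> complex"
  assumes cinner_add_left: "cinner (x + y) z = cinner x z + cinner y z"
    and cinner_scaleC_left: "cinner (c *\<^sub>C x) y = c * cinner x y"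
    and cinner_commute: "cinner x y = cnj (cinner y x)"
    and inner_eq_Re_cinner: "inner x y = Re (cinner x y)"

lemma cinner_self: "cinner x x = complex_of_real ((norm x)\<^sup>2)"
proof (rule complex_eqI)
  show "Re (cinner x x) = Re (complex_of_real ((norm x)\<^sup>2))"
    by (simp add: power2_norm_eq_inner inner_eq_Re_cinner)
  have "Im (cinner x x) = - Im (cinner x x)"
    using arg_cong[OF cinner_commute[of x x], of Im] by simp
  then show "Im (cinner x x) = Im (complex_of_real ((norm x)\<^sup>2))" by simp
qed

class chilbert_space = complex_inner + complete_space

instantiation complex :: chilbert_space
begin

definition scaleC_complex :: "complex \<Rightarrow> complex \<Rightarrow> complex"
  where "scaleC_complex c x = c * x"

definition cinner_complex :: "complex \<Rightarrow> complex \<Rightarrow> complex"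
  where "cinner_complex x y = x * cnj y"

instance
  by standard
    (simp_all add: scaleC_complex_def cinner_complex_def algebra_simps scaleR_conv_of_real
      inner_complex_def)

end

instantiation prod :: (complex_vector, complex_vector) complex_vector
begin

definition scaleC_prod :: "complex \<Rightarrow> 'a \<times> 'b \<Rightarrow> 'a \<times> 'b"
  where "scaleC_prod c p = (c *\<^sub>C fst p, c *\<^sub>C snd p)"

instance
  by standard
    (simp_all add: scaleC_prod_def prod_eq_iff scaleC_add_right scaleC_add_left scaleC_scaleC
      scaleC_one scaleR_scaleC)

end

abbreviation clinear :: "('a::complex_vector \<Rightarrow> 'b::complex_vector) \<Rightarrow> bool"
  where "clinear \<equiv> Vector_Spaces.linear scaleC scaleC"

definition clinear_on :: "'a::complex_vector set \<Rightarrow> ('a \<Rightarrow> 'b::complex_vector) \<Rightarrow> bool"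
  where "clinear_on D f \<longleftrightarrow>
    (\<forall>x\<in>D. \<forall>y\<in>D. f (x + y) = f x + f y) \<and> (\<forall>c. \<forall>x\<in>D. f (c *\<^sub>C x) = c *\<^sub>C f x)"

text \<open>Dimension with values in the natural numbers extended by infinity.\<close>

definition ecdim :: "'a::complex_vector set \<Rightarrow> enat"
  where "ecdim V =
    (if \<exists>B. finite B \<and> V \<subseteq> complex_vector.span B then enat (complex_vector.dim V) else \<infinity>)"

definition unitary_op :: "('a::complex_inner \<Rightarrow> 'a) \<Rightarrow> bool"
  where "unitary_op U \<longleftrightarrow>
    clinear U \<and> surj U \<and> (\<forall>x y. cinner (U x) (U y) = cinner x y)"

definition compact_op :: "('a::complex_inner \<Rightarrow> 'b::complex_inner) \<Rightarrow> bool"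
  where "compact_op K \<longleftrightarrow> clinear K \<and> (\<forall>B. bounded B \<longrightarrow> compact (closure (K ` B)))"

subsection \<open>Unbounded operators\<close>

text \<open>
  An operator is identified with its graph: \<open>(x, w) \<in> A\<close> says that \<open>x\<close> is in the domain of
  \<open>A\<close>, which is \<open>Domain A\<close>, and that \<open>A x = w\<close>. Extension of operators is inclusion.
\<close>

type_synonym 'a operator = "('a \<times> 'a) set"

definition linear_operator :: "'a::complex_vector operator \<Rightarrow> bool"
  where "linear_operator A \<longleftrightarrow> complex_vector.subspace A \<and> single_valued A"

definition densely_defined :: "'a::complex_inner operator \<Rightarrow> bool"
  where "densely_defined A \<longleftrightarrow> closure (Domain A) = UNIV"

definition symmetric_operator :: "'a::complex_inner operator \<Rightarrow> bool"
  where "symmetric_operator A \<longleftrightarrow> (\<forall>(x, u)\<in>A. \<forall>(y, v)\<in>A. cinner u y = cinner x v)"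

text \<open>The adjoint is single-valued, hence an operator, if \<open>A\<close> is densely defined.\<close>

definition adjoint_op :: "'a::complex_inner operator \<Rightarrow> 'a operator"
  where "adjoint_op A = {(y, z). \<forall>(x, w)\<in>A. cinner w y = cinner x z}"

definition self_adjoint :: "'a::complex_inner operator \<Rightarrow> bool"
  where "self_adjoint A \<longleftrightarrow> linear_operator A \<and> densely_defined A \<and> adjoint_op A = A"

definition self_adjoint_extension :: "'a::complex_inner operator \<Rightarrow> 'a operator \<Rightarrow> bool"
  where "self_adjoint_extension T A \<longleftrightarrow> self_adjoint A \<and> T \<subseteq> A \<and> A \<subseteq> adjoint_op T"

definition restrict_op :: "'a operator \<Rightarrow> 'a set \<Rightarrow> 'a operator"
  where "restrict_op A D = {(x, w) \<in> A. x \<in> D}"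

text \<open>The operator \<open>A - z\<close>.\<close>

definition shift_op :: "'a::complex_vector operator \<Rightarrow> complex \<Rightarrow> 'a operator"
  where "shift_op A z = {(x, w - z *\<^sub>C x) | x w. (x, w) \<in> A}"

definition ker_op :: "'a::zero operator \<Rightarrow> 'a set"
  where "ker_op A = {x. (x, 0) \<in> A}"

definition equal_deficiency_indices :: "'a::complex_inner operator \<Rightarrow> bool"
  where "equal_deficiency_indices T \<longleftrightarrow>
    ecdim (ker_op (shift_op (adjoint_op T) \<i>)) = ecdim (ker_op (shift_op (adjoint_op T) (- \<i>)))"

text \<open>
  The converse of the graph of \<open>A - \<i>\<close> is the graph of the inverse; it has to be the graph of a
  compact operator defined on the whole space.
\<close>

definition compact_resolvent :: "'a::complex_inner operator \<Rightarrow> bool"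
  where "compact_resolvent A \<longleftrightarrow>
    (\<exists>R. compact_op R \<and> (shift_op A \<i>)\<inverse> = {(y, R y) | y. True})"

subsection \<open>Boundary triplets\<close>

text \<open>
  The Hilbert space \<open>G\<close> is the codomain type \<open>'b\<close>. The values of \<open>\<Gamma>\<^sub>0\<close> and \<open>\<Gamma>\<^sub>1\<close> outside the
  domain of the adjoint are irrelevant.
\<close>

definition boundary_triplet ::
  "'a::complex_inner operator \<Rightarrow> ('a \<Rightarrow> 'b::chilbert_space) \<Rightarrow> ('a \<Rightarrow> 'b) \<Rightarrow> bool"
  where "boundary_triplet T \<Gamma>\<^sub>0 \<Gamma>\<^sub>1 \<longleftrightarrow>
    clinear_on (Domain (adjoint_op T)) \<Gamma>\<^sub>0 \<and>
    clinear_on (Domain (adjoint_op T)) \<Gamma>\<^sub>1 \<and>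
    (\<lambda>x. (\<Gamma>\<^sub>0 x, \<Gamma>\<^sub>1 x)) ` Domain (adjoint_op T) = UNIV \<and>
    (\<forall>(x, u)\<in>adjoint_op T. \<forall>(y, v)\<in>adjoint_op T.
      cinner u y - cinner x v = cinner (\<Gamma>\<^sub>1 x) (\<Gamma>\<^sub>0 y) - cinner (\<Gamma>\<^sub>0 x) (\<Gamma>\<^sub>1 y))"

definition triplet_extension ::
  "'a::complex_inner operator \<Rightarrow> ('a \<Rightarrow> 'b::chilbert_space) \<Rightarrow> ('a \<Rightarrow> 'b) \<Rightarrow> ('b \<Rightarrow> 'b)
    \<Rightarrow> 'a operator"
  where "triplet_extension T \<Gamma>\<^sub>0 \<Gamma>\<^sub>1 U = restrict_op (adjoint_op T)
    {x \<in> Domain (adjoint_op T). \<Gamma>\<^sub>1 x - U (\<Gamma>\<^sub>1 x) = \<i> *\<^sub>C (\<Gamma>\<^sub>0 x + U (\<Gamma>\<^sub>0 x))}"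

end

theory Submission
  imports Defs
begin

text \<open>
  Put \<open>p = \<Gamma>\<^sub>1 + \<i>\<Gamma>\<^sub>0\<close> and \<open>q = \<Gamma>\<^sub>1 - \<i>\<Gamma>\<^sub>0\<close>. Green's identity becomes
  \<open>(T\<^sup>*x, y) - (x, T\<^sup>*y) = (\<i>/2) ((p x, p y) - (q x, q y))\<close>, and \<open>T\<^sub>U\<close> is the restriction of
  \<open>T\<^sup>*\<close> to \<open>{x. q x = U (p x)}\<close>. Hence self-adjoint extensions correspond to the maximal isometric
  relations \<open>{(p x, q x)}\<close> on \<open>G\<close>, which are the graphs of unitary operators. The open mapping
  theorem shows that \<open>p\<close>, \<open>q\<close> are bounded for the graph norm and have a bounded joint right inverse.
  On \<open>ker (T\<^sup>* - \<i>)\<close> the map \<open>p - q\<close> is bounded above and below, and it sends the difference of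
  the resolvents of \<open>T\<^sub>U\<close> and \<open>T\<^sub>I\<^sub>d\<close> at \<open>f\<close> to \<open>(Id - U) p ((T\<^sub>U - \<i>)\<^sup>-\<^sup>1 f)\<close>. As
  \<open>f \<mapsto> p ((T\<^sub>U - \<i>)\<^sup>-\<^sup>1 f)\<close> is bounded and onto \<open>G\<close> with a bounded section, this difference
  is compact exactly if \<open>U - Id\<close> is.
\<close>

subsection \<open>Banach and Hilbert space preliminaries\<close>

text \<open>
  This is the open mapping theorem: take the converse of the graph of a bounded surjection.
\<close>

lemma closed_relation_bounded_section:
  fixes L :: "('a::banach \<times> 'b::banach) set"
  assumes L: "subspace L" "closed L" "Domain L = UNIV"
  obtains C where "C > 0" "\<And>x. \<exists>y. (x, y) \<in> L \<and> norm y \<le> C * norm x"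
proof -
  have L_add: "(a + b, y + z) \<in> L" if "(a, y) \<in> L" "(b, z) \<in> L" for a b y z
    using subspace_add[OF L(1) that] by simp
  have L_scale: "(t *\<^sub>R a, t *\<^sub>R y) \<in> L" if "(a, y) \<in> L" for t a y
    using subspace_scale[OF L(1) that, of t] by simp
  have L_diff: "(a - b, y - z) \<in> L" if "(a, y) \<in> L" "(b, z) \<in> L" for a b y z
    using subspace_diff[OF L(1) that] by simp
  have L_0: "(0, 0) \<in> L"
    using subspace_0[OF L(1)] by (simp add: zero_prod_def)
  define E where "E n = {x. \<exists>y. (x, y) \<in> L \<and> norm y \<le> real n}" for n
  \<comment> \<open>Every point lies in some \<open>E n\<close> because \<open>L\<close> is total.
    Baire's theorem in the first factor therefore gives an \<open>n\<close> for which the closure of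
    \<open>E n\<close> contains a ball.\<close>
  have "\<exists>n. interior (closure (E n)) \<noteq> {}"
  proof (rule ccontr)
    assume "\<not> ?thesis"
    then have "(euclidean :: 'a topology) interior_of \<Union> (range (\<lambda>n. closure (E n))) = {}"
      by (intro Baire_category_alt) (auto simp: completely_metrizable_space_euclidean)
    moreover have "x \<in> (\<Union>n. closure (E n))" for x
    proof -
      obtain y where y: "(x, y) \<in> L" using L(3) by (metis Domain.cases UNIV_I)
      obtain n where "norm y \<le> real n" using real_arch_simple by blast
      then have "x \<in> E n" using y by (auto simp: E_def)
      then show ?thesis using closure_subset by blast
    qed
    then have "(\<Union>n. closure (E n)) = UNIV" by blast
    ultimately show False by simp
  qed
  then obtain n x0 where "x0 \<in> interior (closure (E n))" by blast
  then obtain r where r: "r > 0" "ball x0 r \<subseteq> closure (E n)"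
    by (meson mem_interior)
  \<comment> \<open>Half the difference of approximants to \<open>x0 + z\<close> and
    \<open>x0 - z\<close> approximates \<open>z\<close>. This moves the ball to the origin while
    keeping the bound \<open>n\<close>.\<close>
  have near: "\<exists>a y. (a, y) \<in> L \<and> norm y \<le> real n \<and> norm (z - a) < e"
    if z: "norm z < r" and e: "e > 0" for z e
  proof -
    have "x0 + z \<in> closure (E n)" "x0 - z \<in> closure (E n)"
      using r z by (auto simp: dist_norm subset_iff)
    then obtain a b where ab: "a \<in> E n" "b \<in> E n" "dist a (x0 + z) < e" "dist b (x0 - z) < e"
      using e unfolding closure_approachable by blast
    then obtain y w where yw: "(a, y) \<in> L" "norm y \<le> n" "(b, w) \<in> L" "norm w \<le> n"
      by (auto simp: E_def)
    have "((1/2) *\<^sub>R (a - b), (1/2) *\<^sub>R (y - w)) \<in> L"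
      using yw by (intro L_scale L_diff)
    moreover have "norm ((1/2) *\<^sub>R (y - w)) \<le> real n"
      using norm_triangle_ineq4[of y w] yw by simp
    moreover have "norm (z - (1/2) *\<^sub>R (a - b)) < e"
    proof -
      have "z - (1/2) *\<^sub>R (a - b) = (1/2) *\<^sub>R ((x0 + z - a) - (x0 - z - b))"
        by (simp add: algebra_simps flip: scaleR_add_left)
      moreover have "norm ((x0 + z - a) - (x0 - z - b)) < e + e"
        using norm_triangle_ineq4[of "x0 + z - a" "x0 - z - b"] ab
        by (simp add: dist_norm norm_minus_commute)
      ultimately show ?thesis by simp
    qed
    ultimately show ?thesis by blast
  qed
  \<comment> \<open>Rescaling from norm \<open>r / 2\<close> back to \<open>norm z\<close> costs the
    factor \<open>2 * norm z / r\<close>. The summand 1 keeps \<open>K\<close> positive when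
    \<open>n = 0\<close>.\<close>
  define K where "K = 2 * real n / r + 1"
  have K: "K > 0" using r by (simp add: K_def add_nonneg_pos)
  have "\<exists>p. p \<in> L \<and> norm (snd p) \<le> K * norm z \<and> norm (z - fst p) \<le> norm z / 2" for z
  proof (cases "z = 0")
    case True
    then show ?thesis using L_0 by (intro exI[of _ "(0, 0)"]) simp
  next
    case False
    define t where "t = r / (2 * norm z)"
    have t: "t > 0" using r False by (simp add: t_def)
    have "norm (t *\<^sub>R z) < r" using r False by (simp add: t_def)
    moreover have "t * (norm z / 2) > 0" using t False by simp
    ultimately obtain a y where ay: "(a, y) \<in> L" "norm y \<le> real n"
      "norm (t *\<^sub>R z - a) < t * (norm z / 2)"
      using near by blast
    have "z - (1/t) *\<^sub>R a = (1/t) *\<^sub>R (t *\<^sub>R z - a)"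
      using t by (simp add: algebra_simps)
    then have "norm (z - (1/t) *\<^sub>R a) = (1/t) * norm (t *\<^sub>R z - a)"
      using t by simp
    also have "\<dots> \<le> norm z / 2" using ay(3) t by (simp add: field_simps)
    finally have 1: "norm (z - (1/t) *\<^sub>R a) \<le> norm z / 2" .
    have "norm ((1/t) *\<^sub>R y) \<le> real n / t" using ay t by (simp add: divide_right_mono)
    also have "\<dots> \<le> K * norm z" using r False by (simp add: K_def t_def field_simps)
    finally have "norm ((1/t) *\<^sub>R y) \<le> K * norm z" .
    then show ?thesis using 1 L_scale[OF ay(1), of "1/t"]
      by (intro exI[of _ "((1/t) *\<^sub>R a, (1/t) *\<^sub>R y)"]) simp
  qed
  then obtain f where f: "\<And>z. f z \<in> L" "\<And>z. norm (snd (f z)) \<le> K * norm z"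
    "\<And>z. norm (z - fst (f z)) \<le> norm z / 2"
    by metis
  \<comment> \<open>Successive approximation: each remainder has at most half the norm of the
    previous one, so the corrections are dominated by a geometric series with sum
    \<open>2 * K * norm x\<close>. Closedness of \<open>L\<close> puts the limit into
    \<open>L\<close>.\<close>
  have main: "\<exists>y. (x, y) \<in> L \<and> norm y \<le> (2 * K) * norm x" for x
  proof -
    define z where "z k = ((\<lambda>z. z - fst (f z)) ^^ k) x" for k
    have z_Suc: "z (Suc k) = z k - fst (f (z k))" and z0: "z 0 = x" for k
      by (simp_all add: z_def)
    have z_le: "norm (z k) \<le> norm x * (1/2) ^ k" for k
    proof (induction k)
      case (Suc k)
      then show ?case using f(3)[of "z k"] by (simp add: z_Suc)
    qed (simp add: z0)
    define y where "y k = snd (f (z k))" for k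
    have y_le: "norm (y k) \<le> (K * norm x) * (1/2) ^ k" for k
      using order_trans[OF f(2)[of "z k"] mult_left_mono[OF z_le[of k], of K]] K
      by (simp add: y_def mult_ac)
    have geo: "(\<lambda>k. (K * norm x) * (1/2) ^ k) sums ((K * norm x) * 2)"
      using sums_mult[OF geometric_sums[of "1/2::real"], of "K * norm x"] by simp
    have sum_y: "summable y"
      using summable_comparison_test'[OF sums_summable[OF geo], of 0 y] y_le by simp
    have sn: "summable (\<lambda>k. norm (y k))"
      using summable_comparison_test'[OF sums_summable[OF geo], of 0 "\<lambda>k. norm (y k)"] y_le by simp
    have "norm (suminf y) \<le> (K * norm x) * 2"
      using summable_norm[OF sn] suminf_le[OF y_le sn sums_summable[OF geo]] sums_unique[OF geo]
      by simp
    moreover have "(x, suminf y) \<in> L"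
    proof (rule closed_sequentially[OF L(2)])
      show "(x - z k, \<Sum>j<k. y j) \<in> L" for k
      proof (induction k)
        case (Suc k)
        then show ?case using L_add[OF Suc, of "fst (f (z k))" "y k"] f(1)[of "z k"]
          by (simp add: z_Suc y_def algebra_simps)
      qed (simp add: z0 L_0)
      have "z \<longlonglongrightarrow> 0"
      proof (rule Lim_null_comparison)
        show "\<forall>\<^sub>F k in sequentially. norm (z k) \<le> norm x * (1/2) ^ k" using z_le by simp
        show "(\<lambda>k. norm x * (1/2) ^ k) \<longlonglongrightarrow> 0"
          by (intro tendsto_mult_right_zero LIMSEQ_power_zero) simp
      qed
      then have "(\<lambda>k. x - z k) \<longlonglongrightarrow> x - 0" by (intro tendsto_intros)
      then show "(\<lambda>k. (x - z k, \<Sum>j<k. y j)) \<longlonglongrightarrow> (x, suminf y)"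
        using summable_LIMSEQ[OF sum_y] by (intro tendsto_Pair) simp_all
    qed
    ultimately show ?thesis by (intro exI[of _ "suminf y"]) (simp add: mult_ac)
  qed
  show thesis using that[of "2 * K"] main K by simp
qed

text \<open>The vector is \<open>x - l\<close>, where \<open>x\<close> lies outside \<open>S\<close>
  and \<open>l\<close> is the point of \<open>S\<close> nearest to it. Completeness provides
  \<open>l\<close> as the limit of a minimizing sequence.\<close>

lemma closed_subspace_orthogonal_vector:
  fixes S :: "'a::{real_inner, complete_space} set"
  assumes S: "subspace S" "closed S" "S \<noteq> UNIV"
  obtains z where "z \<noteq> 0" "\<And>s. s \<in> S \<Longrightarrow> inner z s = 0"
proof -
  obtain x where x: "x \<notin> S" using S(3) by blast
  define d where "d = infdist x S"
  have ne: "S \<noteq> {}" using subspace_0[OF S(1)] by blast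
  have d_le: "d \<le> norm (x - s)" if "s \<in> S" for s
    using infdist_le[OF that, of x] by (simp add: d_def dist_norm)
  have d0: "d \<ge> 0" by (simp add: d_def infdist_nonneg)
  have "\<exists>s\<in>S. (norm (x - s))\<^sup>2 < d\<^sup>2 + 1 / Suc k" for k
  proof -
    have "d < sqrt (d\<^sup>2 + 1 / Suc k)"
      by (rule real_less_rsqrt) (simp add: d0)
    then obtain s where s: "s \<in> S" "dist x s < sqrt (d\<^sup>2 + 1 / Suc k)"
      using ne by (auto simp: d_def infdist_def cInf_less_iff)
    then have "(norm (x - s))\<^sup>2 < (sqrt (d\<^sup>2 + 1 / Suc k))\<^sup>2"
      by (intro power_strict_mono) (auto simp: dist_norm)
    then show ?thesis using s by auto
  qed
  then obtain s where s: "\<And>k. s k \<in> S" "\<And>k. (norm (x - s k))\<^sup>2 < d\<^sup>2 + 1 / Suc k"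
    by metis
  \<comment> \<open>The midpoint of \<open>s i\<close> and \<open>s j\<close> lies in
    \<open>S\<close>, so its distance from \<open>x\<close> is at least \<open>d\<close>. The
    parallelogram law then turns near minimality of both points into closeness to each
    other.\<close>
  have par: "(norm (s i - s j))\<^sup>2 \<le> 2 / Suc i + 2 / Suc j" for i j
  proof -
    let ?m = "(1/2) *\<^sub>R (s i + s j)"
    have "?m \<in> S" using s(1) S(1) by (intro subspace_scale subspace_add)
    then have "d\<^sup>2 \<le> (norm (x - ?m))\<^sup>2" using d_le d0 by (intro power_mono)
    moreover have "(norm (s i - s j))\<^sup>2 + 4 * (norm (x - ?m))\<^sup>2
        = 2 * (norm (x - s i))\<^sup>2 + 2 * (norm (x - s j))\<^sup>2"
      unfolding power2_norm_eq_inner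
      by (simp add: inner_diff_left inner_diff_right inner_add_left inner_add_right inner_commute
          field_simps)
    moreover have "2 / Suc i = 2 * (1 / Suc i)" "2 / Suc j = 2 * (1 / Suc j)" by simp_all
    ultimately show ?thesis using s(2)[of i] s(2)[of j] by linarith
  qed
  have "Cauchy s"
  proof (rule metric_CauchyI)
    fix e :: real assume e: "e > 0"
    obtain N where N: "4 / e\<^sup>2 < real N" using reals_Archimedean2 by blast
    have "dist (s i) (s j) < e" if "i \<ge> N" "j \<ge> N" for i j
    proof -
      have N0: "real N > 0" using N e by (smt (verit) divide_pos_pos zero_less_power)
      have "2 / Suc i + 2 / Suc j \<le> 2 / N + 2 / N"
        using that N0 by (intro add_mono divide_left_mono) auto
      also have "\<dots> < e\<^sup>2" using N N0 e by (simp add: field_simps)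
      finally have "(norm (s i - s j))\<^sup>2 < e\<^sup>2" using par[of i j] by simp
      then show ?thesis using e by (simp add: dist_norm power_less_imp_less_base)
    qed
    then show "\<exists>M. \<forall>m\<ge>M. \<forall>n\<ge>M. dist (s m) (s n) < e" by blast
  qed
  then obtain l where l: "s \<longlonglongrightarrow> l" using Cauchy_convergent convergent_def by blast
  have lS: "l \<in> S" using closed_sequentially[OF S(2) s(1) l] .
  have "(\<lambda>k. (norm (x - s k))\<^sup>2) \<longlonglongrightarrow> (norm (x - l))\<^sup>2" by (intro tendsto_intros l)
  moreover have "(\<lambda>k. d\<^sup>2 + 1 / Suc k) \<longlonglongrightarrow> d\<^sup>2 + 0"
    using LIMSEQ_inverse_real_of_nat by (intro tendsto_intros) (simp add: inverse_eq_divide)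
  ultimately have "(norm (x - l))\<^sup>2 \<le> d\<^sup>2 + 0"
    by (rule LIMSEQ_le) (use s(2) less_imp_le in blast)
  then have min: "norm (x - l) \<le> d" using d0 by (simp add: power2_le_iff_abs_le)
  have "inner (x - l) v = 0" if v: "v \<in> S" for v
  proof (rule ccontr)
    assume nz: "inner (x - l) v \<noteq> 0"
    then have v0: "inner v v > 0" by auto
    \<comment> \<open>This \<open>t\<close> minimizes the distance from \<open>x\<close> to the line
      through \<open>l\<close> in direction \<open>v\<close>. With a nonzero inner product that
      distance would be smaller than the one at \<open>l\<close>.\<close>
    define t where "t = inner (x - l) v / inner v v"
    have "l + t *\<^sub>R v \<in> S" using lS v S(1) by (intro subspace_add subspace_scale)
    then have "norm (x - l) \<le> norm (x - (l + t *\<^sub>R v))" using d_le min by force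
    then have "inner (x - l) (x - l) \<le> inner (x - l - t *\<^sub>R v) (x - l - t *\<^sub>R v)"
      by (simp add: norm_le diff_diff_eq)
    also have "\<dots> = inner (x - l) (x - l) - 2 * t * inner (x - l) v + t\<^sup>2 * inner v v"
      by (simp add: inner_diff_left inner_diff_right inner_commute power2_eq_square algebra_simps)
    also have "t\<^sup>2 * inner v v = t * inner (x - l) v"
      using v0 by (simp add: t_def power2_eq_square)
    finally have "t * inner (x - l) v \<le> 0" by simp
    moreover have "t * inner (x - l) v = (inner (x - l) v)\<^sup>2 / inner v v"
      by (simp add: t_def power2_eq_square)
    ultimately show False using v0 nz by (simp add: divide_le_0_iff)
  qed
  moreover have "x - l \<noteq> 0" using x lS by auto
  ultimately show thesis using that by blast
qed

section \<open>Complex inner products\<close>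

instance chilbert_space \<subseteq> banach ..

lemma scaleC_diff_right: "c *\<^sub>C (x - y) = c *\<^sub>C x - c *\<^sub>C y"
  by (rule complex_vector.scale_right_diff_distrib)

lemma cinner_add_right: "cinner x (y + z) = cinner x y + cinner x z"
  by (metis cinner_add_left cinner_commute complex_cnj_add)

lemma cinner_scaleC_right: "cinner x (c *\<^sub>C y) = cnj c * cinner x y"
  by (metis cinner_scaleC_left cinner_commute complex_cnj_mult)

lemma cinner_zero_left [simp]: "cinner 0 x = 0"
  using cinner_add_left[of 0 0 x] by simp

lemma cinner_zero_right [simp]: "cinner x 0 = 0"
  using cinner_add_right[of x 0 0] by simp

lemma cinner_minus_left [simp]: "cinner (- x) y = - cinner x y"
  using cinner_add_left[of x "- x" y] by (simp add: eq_neg_iff_add_eq_0 add.commute)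

lemma cinner_minus_right [simp]: "cinner x (- y) = - cinner x y"
  using cinner_add_right[of x y "- y"] by (simp add: eq_neg_iff_add_eq_0 add.commute)

lemma cinner_diff_left: "cinner (x - y) z = cinner x z - cinner y z"
  using cinner_add_left[of x "- y" z] by simp

lemma cinner_diff_right: "cinner x (y - z) = cinner x y - cinner x z"
  using cinner_add_right[of x y "- z"] by simp

lemma norm_scaleC [simp]: "norm (c *\<^sub>C x) = cmod c * norm (x :: 'a::complex_inner)"
proof -
  have "complex_of_real ((norm (c *\<^sub>C x))\<^sup>2) = c * cnj c * cinner x x"
    by (simp only: flip: cinner_self) (simp add: cinner_scaleC_left cinner_scaleC_right)
  also have "\<dots> = complex_of_real ((cmod c * norm x)\<^sup>2)"
    by (simp add: cinner_self complex_norm_square power_mult_distrib flip: of_real_power)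
  finally have "(norm (c *\<^sub>C x))\<^sup>2 = (cmod c * norm x)\<^sup>2"
    by (simp only: of_real_eq_iff)
  then show ?thesis by (simp add: power2_eq_iff_nonneg)
qed

lemma Im_cinner: "Im (cinner x y) = inner x (\<i> *\<^sub>C y)"
  by (simp add: inner_eq_Re_cinner cinner_scaleC_right)

text \<open>A unimodular factor rotates the inner product onto the nonnegative real axis, where it
  equals a real inner product and the real Cauchy-Schwarz inequality applies.\<close>

lemma norm_cinner_le: "cmod (cinner x y) \<le> norm x * norm y"
proof -
  obtain c where c: "cmod c = 1" "c * cinner x y = complex_of_real (cmod (cinner x y))"
  proof (cases "cinner x y = 0")
    case False
    then show ?thesis
      by (intro that[of "complex_of_real (cmod (cinner x y)) / cinner x y"])
        (simp_all add: norm_divide)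
  qed (use that[of 1] in simp)
  have "cmod (cinner x y) = inner (c *\<^sub>C x) y"
    using c(2) by (simp add: inner_eq_Re_cinner cinner_scaleC_left)
  also have "\<dots> \<le> norm (c *\<^sub>C x) * norm y" by (rule norm_cauchy_schwarz)
  finally show ?thesis using c(1) by simp
qed

lemma bounded_bilinear_cinner: "bounded_bilinear cinner"
  by standard
    (auto simp: cinner_add_left cinner_add_right scaleR_scaleC cinner_scaleC_left
      cinner_scaleC_right scaleC_complex_def intro!: exI[of _ 1] norm_cinner_le)

lemmas tendsto_cinner = bounded_bilinear.tendsto[OF bounded_bilinear_cinner]

lemma tendsto_scaleC_const:
  fixes f :: "'b \<Rightarrow> 'a::complex_inner"
  assumes "(f \<longlongrightarrow> l) F"
  shows "((\<lambda>x. c *\<^sub>C f x) \<longlongrightarrow> c *\<^sub>C l) F"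
proof -
  have "bounded_linear (\<lambda>x::'a. c *\<^sub>C x)"
    by (rule bounded_linear_intro[of _ "cmod c"])
      (simp_all add: scaleC_add_right scaleR_scaleC scaleC_scaleC mult.commute)
  then show ?thesis using assms by (rule bounded_linear.tendsto)
qed

lemma cinner_eq_0_denseD:
  fixes z :: "'a::complex_inner"
  assumes "closure D = UNIV" "\<And>x. x \<in> D \<Longrightarrow> cinner x z = 0"
  shows "z = 0"
proof -
  have "z \<in> closure D" using assms(1) by simp
  then obtain f where f: "\<And>n. f n \<in> D" "f \<longlonglongrightarrow> z"
    using closure_sequential by blast
  have "(\<lambda>n. cinner (f n) z) \<longlonglongrightarrow> cinner z z" by (intro tendsto_cinner f tendsto_const)
  moreover have "(\<lambda>n. cinner (f n) z) = (\<lambda>n. 0)" using assms(2) f(1) by auto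
  ultimately have "cinner z z = 0" using LIMSEQ_unique tendsto_const by metis
  then show ?thesis by (simp add: cinner_self)
qed

lemma csubspace_imp_subspace: "complex_vector.subspace S \<Longrightarrow> subspace S"
  unfolding complex_vector.subspace_def subspace_def by (metis scaleR_scaleC)

lemma clinear_iff:
  "clinear f \<longleftrightarrow> (\<forall>x y. f (x + y) = f x + f y) \<and> (\<forall>c x. f (c *\<^sub>C x) = c *\<^sub>C f x)"
  by (simp add: Vector_Spaces.linear_iff complex_vector.vector_space_axioms)

text \<open>A vector that is real-orthogonal to \<open>S\<close> is also complex-orthogonal to it:
  the imaginary part of \<open>cinner z s\<close> is the real inner product of \<open>z\<close> with
  \<open>\<i> *\<^sub>C s\<close>, which again lies in \<open>S\<close>.\<close>

lemma closed_csubspace_eq_UNIVI: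
  fixes S :: "'a::chilbert_space set"
  assumes S: "complex_vector.subspace S" "closed S"
    and orth: "\<And>z. (\<And>s. s \<in> S \<Longrightarrow> cinner s z = 0) \<Longrightarrow> z = 0"
  shows "S = UNIV"
proof (rule ccontr)
  assume "S \<noteq> UNIV"
  then obtain z where z: "z \<noteq> 0" "\<And>s. s \<in> S \<Longrightarrow> inner z s = 0"
    using closed_subspace_orthogonal_vector csubspace_imp_subspace S by metis
  have "cinner z s = 0" if "s \<in> S" for s
  proof (rule complex_eqI)
    show "Re (cinner z s) = Re 0" using z(2)[OF that] by (simp add: inner_eq_Re_cinner)
    have "\<i> *\<^sub>C s \<in> S" using S(1) that by (rule complex_vector.subspace_scale)
    then show "Im (cinner z s) = Im 0" using z(2) by (simp add: Im_cinner)
  qed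
  then have "cinner s z = 0" if "s \<in> S" for s
    by (metis that cinner_commute complex_cnj_zero)
  then show False using orth z(1) by blast
qed

lemma clinear_diff: "clinear f \<Longrightarrow> f (x - y) = f x - f y"
  by (simp add: clinear_iff eq_diff_eq flip: scaleC_add_right)
    (metis diff_add_cancel)

lemma clinear_0: "clinear f \<Longrightarrow> f 0 = 0"
  using clinear_diff[of f 0 0] by simp

section \<open>Compact operators\<close>

lemma compact_op_bound:
  assumes "compact_op K"
  obtains C where "C > 0" "\<And>x. norm (K x) \<le> C * norm x"
proof -
  have K: "clinear K" using assms by (simp add: compact_op_def)
  have "compact (closure (K ` cball 0 1))" using assms by (simp add: compact_op_def)
  then have "bounded (K ` cball 0 1)"
    using bounded_subset[OF compact_imp_bounded closure_subset] by blast
  then obtain C where C: "C > 0" "\<And>x. norm x \<le> 1 \<Longrightarrow> norm (K x) \<le> C"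
    by (auto simp: bounded_pos)
  have "norm (K x) \<le> C * norm x" for x
  proof (cases "x = 0")
    case True
    then show ?thesis using clinear_0[OF K] by simp
  next
    case False
    then have "norm (K (complex_of_real (1 / norm x) *\<^sub>C x)) \<le> C"
      by (intro C(2)) (simp add: norm_divide)
    then show ?thesis using K False by (simp add: clinear_iff norm_divide field_simps)
  qed
  then show thesis using that C(1) by blast
qed

lemma compact_closure_subset:
  fixes S :: "'a::t2_space set"
  assumes "S \<subseteq> K" "compact K"
  shows "compact (closure S)"
proof -
  have "closure S \<subseteq> K" using assms by (intro closure_minimal compact_imp_closed)
  then have "K \<inter> closure S = closure S" by blast
  then show ?thesis using compact_Int_closed[OF assms(2) closed_closure, of S] by simp
qed

text \<open>On a bounded set the domination makes \<open>K x\<close> a Lipschitz function of the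
  pair \<open>K1 (\<phi> x)\<close>, \<open>K2 (\<psi> x)\<close>, which ranges over a relatively
  compact set. The bound is stated for differences because \<open>\<phi>\<close> and
  \<open>\<psi>\<close> may be nonlinear sections obtained by choice.\<close>

lemma compact_op_dominated:
  fixes K :: "'a::complex_inner \<Rightarrow> 'b::chilbert_space"
    and K1 :: "'c::complex_inner \<Rightarrow> 'd::complex_inner"
    and K2 :: "'e::complex_inner \<Rightarrow> 'f::complex_inner"
  assumes K: "clinear K" and K1: "compact_op K1" and K2: "compact_op K2"
    and \<phi>: "\<And>x. norm (\<phi> x) \<le> c * norm x" and \<psi>: "\<And>x. norm (\<psi> x) \<le> c * norm x"
    and dom: "\<And>x y. norm (K x - K y)
      \<le> C * (norm (K1 (\<phi> x) - K1 (\<phi> y)) + norm (K2 (\<psi> x) - K2 (\<psi> y)))"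
  shows "compact_op K"
  unfolding compact_op_def
proof (intro conjI allI impI K)
  fix B :: "'a set" assume "bounded B"
  then obtain b where b: "b > 0" "\<And>x. x \<in> B \<Longrightarrow> norm x \<le> b" by (auto simp: bounded_pos)
  have bd: "bounded (\<phi> ` B)" "bounded (\<psi> ` B)"
  proof -
    have "c * norm x \<le> \<bar>c\<bar> * b" if "x \<in> B" for x
      by (intro mult_mono b that) auto
    then have "norm (\<phi> x) \<le> \<bar>c\<bar> * b" "norm (\<psi> x) \<le> \<bar>c\<bar> * b" if "x \<in> B" for x
      using \<phi> \<psi> that order_trans by blast+
    then show "bounded (\<phi> ` B)" "bounded (\<psi> ` B)"
      unfolding bounded_iff by blast+
  qed
  define F where "F x = (K1 (\<phi> x), K2 (\<psi> x))" for x
  \<comment> \<open>The chosen preimage does not matter: by the domination, points with equal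
    \<open>F\<close> have equal \<open>K\<close>.\<close>
  define h where "h z = K (SOME x. x \<in> B \<and> F x = z)" for z
  have dF: "dist (K x) (K y) \<le> (2 * \<bar>C\<bar>) * dist (F x) (F y)" for x y
  proof -
    have "dist (K x) (K y) \<le> C * (dist (K1 (\<phi> x)) (K1 (\<phi> y)) + dist (K2 (\<psi> x)) (K2 (\<psi> y)))"
      using dom by (simp add: dist_norm)
    also have "\<dots> \<le> \<bar>C\<bar> * (dist (F x) (F y) + dist (F x) (F y))"
      using dist_fst_le[of "F x" "F y"] dist_snd_le[of "F x" "F y"]
      by (intro mult_mono add_mono) (auto simp: F_def)
    finally show ?thesis by simp
  qed
  have hF: "h (F x) = K x" if "x \<in> B" for x
  proof -
    have "(SOME y. y \<in> B \<and> F y = F x) \<in> B \<and> F (SOME y. y \<in> B \<and> F y = F x) = F x"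
      by (rule someI[of _ x]) (use that in simp)
    then show ?thesis using dF[of "SOME y. y \<in> B \<and> F y = F x" x] by (simp add: h_def)
  qed
  have "(2 * \<bar>C\<bar>)-lipschitz_on (F ` B) h"
    by (rule lipschitz_onI) (auto simp: hF dF)
  then have "uniformly_continuous_on (F ` B) h"
    by (rule lipschitz_on_uniformly_continuous)
  \<comment> \<open>Completeness of the target extends the map to the closure of the image of
    \<open>B\<close> under \<open>F\<close>. That closure is compact, so its image under
    \<open>g\<close> is a compact set containing all values of \<open>K\<close> on
    \<open>B\<close>.\<close>
  then obtain g where g: "uniformly_continuous_on (closure (F ` B)) g"
    "\<And>z. z \<in> F ` B \<Longrightarrow> h z = g z"
    using uniformly_continuous_on_extension_on_closure by metis
  have "F ` B \<subseteq> closure (K1 ` \<phi> ` B) \<times> closure (K2 ` \<psi> ` B)"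
    using closure_subset[of "K1 ` \<phi> ` B"] closure_subset[of "K2 ` \<psi> ` B"]
    by (auto simp: F_def)
  moreover have "compact (closure (K1 ` \<phi> ` B) \<times> closure (K2 ` \<psi> ` B))"
    using K1 K2 bd by (intro compact_Times) (auto simp: compact_op_def)
  ultimately have "compact (closure (F ` B))"
    by (rule compact_closure_subset)
  then have cpt: "compact (g ` closure (F ` B))"
    using compact_continuous_image g(1) uniformly_continuous_imp_continuous by blast
  have "K ` B \<subseteq> g ` closure (F ` B)"
  proof
    fix w assume "w \<in> K ` B"
    then obtain x where x: "x \<in> B" "w = K x" by blast
    then have "w = g (F x)" using hF[OF x(1)] g(2)[of "F x"] by simp
    moreover have "F x \<in> closure (F ` B)" using x(1) closure_subset[of "F ` B"] by blast
    ultimately show "w \<in> g ` closure (F ` B)" by blast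
  qed
  then show "compact (closure (K ` B))"
    using cpt by (rule compact_closure_subset)
qed

subsection \<open>Adjoints and resolvents\<close>

lemma adjoint_opI: "(\<And>x w. (x, w) \<in> A \<Longrightarrow> cinner w y = cinner x z) \<Longrightarrow> (y, z) \<in> adjoint_op A"
  by (auto simp: adjoint_op_def)

lemma adjoint_opD: "(y, z) \<in> adjoint_op A \<Longrightarrow> (x, w) \<in> A \<Longrightarrow> cinner w y = cinner x z"
  by (auto simp: adjoint_op_def)

lemma closed_adjoint_op: "closed (adjoint_op A)"
  unfolding closed_sequential_limits
proof (intro allI impI, elim conjE)
  fix f l assume f: "\<forall>n. f n \<in> adjoint_op A" "f \<longlonglongrightarrow> l"
  have "cinner w (fst l) = cinner x (snd l)" if "(x, w) \<in> A" for x w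
  proof (rule LIMSEQ_unique)
    show "(\<lambda>n. cinner w (fst (f n))) \<longlonglongrightarrow> cinner w (fst l)"
      by (intro tendsto_cinner tendsto_const tendsto_fst f)
    have "cinner w (fst (f n)) = cinner x (snd (f n))" for n
      using f(1) that adjoint_opD[of "fst (f n)" "snd (f n)" A x w] by simp
    then show "(\<lambda>n. cinner w (fst (f n))) \<longlonglongrightarrow> cinner x (snd l)"
      by (simp add: tendsto_cinner tendsto_snd f)
  qed
  then show "l \<in> adjoint_op A" by (cases l) (auto intro: adjoint_opI)
qed

lemma subspace_operatorI:
  assumes "(0, 0) \<in> A"
    and "\<And>x u y v. (x, u) \<in> A \<Longrightarrow> (y, v) \<in> A \<Longrightarrow> (x + y, u + v) \<in> A"
    and "\<And>c x u. (x, u) \<in> A \<Longrightarrow> (c *\<^sub>C x, c *\<^sub>C u) \<in> A"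
  shows "complex_vector.subspace A"
  using assms by (auto simp: complex_vector.subspace_def zero_prod_def scaleC_prod_def)

lemma subspace_operatorD:
  assumes "complex_vector.subspace A"
  shows "(0, 0) \<in> A"
    and "(x, u) \<in> A \<Longrightarrow> (y, v) \<in> A \<Longrightarrow> (x + y, u + v) \<in> A"
    and "(x, u) \<in> A \<Longrightarrow> (c *\<^sub>C x, c *\<^sub>C u) \<in> A"
    and "(x, u) \<in> A \<Longrightarrow> (y, v) \<in> A \<Longrightarrow> (x - y, u - v) \<in> A"
  using complex_vector.subspace_0[OF assms] complex_vector.subspace_add[OF assms, of "(x, u)" "(y, v)"]
    complex_vector.subspace_scale[OF assms, of "(x, u)" c]
    complex_vector.subspace_diff[OF assms, of "(x, u)" "(y, v)"]
  by (auto simp: zero_prod_def scaleC_prod_def)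

lemma subspace_adjoint_op: "complex_vector.subspace (adjoint_op A)"
  by (intro subspace_operatorI adjoint_opI)
    (simp_all add: adjoint_opD[of _ _ A] cinner_add_right cinner_scaleC_right)

text \<open>The converse of a shifted graph becomes an equation for a single element of
  \<open>A\<close>, the form in which resolvents are used below.\<close>

lemma resolvent_graph_iff:
  "(shift_op A \<i>)\<inverse> = {(y, R y) | y. True} \<longleftrightarrow> (\<forall>x y. (x, y + \<i> *\<^sub>C x) \<in> A \<longleftrightarrow> x = R y)"
proof -
  have "(y, x) \<in> (shift_op A \<i>)\<inverse> \<longleftrightarrow> (x, y + \<i> *\<^sub>C x) \<in> A" for x y
    by (force simp: shift_op_def)
  then show ?thesis by (auto simp: set_eq_iff)
qed

text \<open>For symmetric \<open>A\<close> the cross terms vanish, so the squared norm of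
  \<open>(A - \<i>) x\<close> is the sum of those of \<open>A x\<close> and \<open>x\<close>. This
  gives injectivity, the contraction bound and, as \<open>A\<close> is closed, a closed range. A
  vector orthogonal to the range is an eigenvector of \<open>A\<close> for \<open>-\<i>\<close> or
  zero, and symmetry excludes the former.\<close>

lemma self_adjoint_resolvent:
  fixes A :: "'a::chilbert_space operator"
  assumes "self_adjoint A"
  obtains R where "clinear R" "\<And>y. norm (R y) \<le> norm y"
    "(shift_op A \<i>)\<inverse> = {(y, R y) | y. True}"
proof -
  have A: "adjoint_op A = A" and sub: "complex_vector.subspace A"
    using assms by (auto simp: self_adjoint_def linear_operator_def)
  note sub' = subspace_operatorD[OF sub]
  have sym: "cinner u y = cinner x v" if "(x, u) \<in> A" "(y, v) \<in> A" for x u y v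
    using adjoint_opD[of y v A x u] that A by simp
  have below: "norm x \<le> norm (u - \<i> *\<^sub>C x)" if "(x, u) \<in> A" for x u
  proof -
    have "cnj (cinner u x) = cinner u x"
      using sym[OF that that] by (metis cinner_commute)
    then have "inner u (\<i> *\<^sub>C x) = 0"
      by (metis Im_cinner Reals_cnj_iff complex_is_Real_iff)
    then have "(norm (u - \<i> *\<^sub>C x))\<^sup>2 = (norm u)\<^sup>2 + (norm (\<i> *\<^sub>C x))\<^sup>2"
      by (simp only: power2_norm_eq_inner) (simp add: inner_diff_left inner_diff_right inner_commute)
    then show ?thesis by (simp add: power2_le_imp_le)
  qed
  define S where "S = {y. \<exists>x. (x, y + \<i> *\<^sub>C x) \<in> A}"
  have "S = UNIV"
  proof (rule closed_csubspace_eq_UNIVI)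
    show "complex_vector.subspace S"
      unfolding complex_vector.subspace_def
    proof (intro conjI ballI allI)
      show "0 \<in> S" unfolding S_def using sub'(1) by (intro CollectI exI[of _ 0]) simp
    next
      fix a b assume "a \<in> S" "b \<in> S"
      then obtain x y where "(x, a + \<i> *\<^sub>C x) \<in> A" "(y, b + \<i> *\<^sub>C y) \<in> A"
        unfolding S_def by blast
      from sub'(2)[OF this] show "a + b \<in> S" unfolding S_def
        by (intro CollectI exI[of _ "x + y"]) (simp add: scaleC_add_right add_ac)
    next
      fix c a assume "a \<in> S"
      then obtain x where "(x, a + \<i> *\<^sub>C x) \<in> A" unfolding S_def by blast
      from sub'(3)[OF this, of c] show "c *\<^sub>C a \<in> S" unfolding S_def
        by (intro CollectI exI[of _ "c *\<^sub>C x"])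
          (simp add: scaleC_add_right scaleC_scaleC mult.commute)
    qed
    show "closed S"
      unfolding closed_sequential_limits
    proof (intro allI impI, elim conjE)
      fix f l assume f: "\<forall>n. f n \<in> S" "f \<longlonglongrightarrow> l"
      then have "\<forall>n. \<exists>x. (x, f n + \<i> *\<^sub>C x) \<in> A" by (simp add: S_def)
      then obtain x where x: "\<And>n. (x n, f n + \<i> *\<^sub>C x n) \<in> A" by metis
      have le: "norm (x m - x n) \<le> norm (f m - f n)" for m n
        using below[OF sub'(4)[OF x[of m] x[of n]]] by (simp add: algebra_simps scaleC_diff_right)
      have "Cauchy x"
        using LIMSEQ_imp_Cauchy[OF f(2)] le unfolding Cauchy_def dist_norm
        by (meson le_less_trans)
      then obtain a where a: "x \<longlonglongrightarrow> a" using Cauchy_convergent convergent_def by blast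
      have lim: "(\<lambda>n. (x n, f n + \<i> *\<^sub>C x n)) \<longlonglongrightarrow> (a, l + \<i> *\<^sub>C a)"
        by (intro tendsto_intros a f tendsto_scaleC_const)
      have "closed A" using closed_adjoint_op[of A] A by simp
      then have "(a, l + \<i> *\<^sub>C a) \<in> A" using x lim by (rule closed_sequentially)
      then show "l \<in> S" unfolding S_def by blast
    qed
  next
    fix z assume z: "\<And>s. s \<in> S \<Longrightarrow> cinner s z = 0"
    have "(z, - (\<i> *\<^sub>C z)) \<in> adjoint_op A"
    proof (rule adjoint_opI)
      fix x w assume "(x, w) \<in> A"
      then have "w - \<i> *\<^sub>C x \<in> S" unfolding S_def by (intro CollectI exI[of _ x]) simp
      from z[OF this] show "cinner w z = cinner x (- (\<i> *\<^sub>C z))"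
        by (simp add: cinner_diff_left cinner_scaleC_left cinner_scaleC_right)
    qed
    then have "(z, - (\<i> *\<^sub>C z)) \<in> A" using A by simp
    from sym[OF this this] show "z = 0"
      by (simp add: cinner_scaleC_left cinner_scaleC_right cinner_self complex_eq_iff)
  qed
  then have ex: "\<exists>x. (x, y + \<i> *\<^sub>C x) \<in> A" for y
  proof -
    have "y \<in> S" using \<open>S = UNIV\<close> by simp
    then show ?thesis unfolding S_def by blast
  qed
  have unique: "x = x'" if "(x, y + \<i> *\<^sub>C x) \<in> A" "(x', y + \<i> *\<^sub>C x') \<in> A" for x x' y
    using below[OF sub'(4)[OF that]] by (simp add: scaleC_diff_right)
  obtain R where R: "\<And>y. (R y, y + \<i> *\<^sub>C R y) \<in> A" using ex by metis
  show thesis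
  proof
    show "norm (R y) \<le> norm y" for y using below[OF R] by simp
    show "(shift_op A \<i>)\<inverse> = {(y, R y) | y. True}"
      unfolding resolvent_graph_iff using R unique by blast
    show "clinear R" unfolding clinear_iff
    proof (intro conjI allI)
      show "R (x + y) = R x + R y" for x y
        using sub'(2)[OF R[of x] R[of y]]
        by (intro unique[OF R]) (simp add: scaleC_add_right algebra_simps)
      show "R (c *\<^sub>C x) = c *\<^sub>C R x" for c x
        using sub'(3)[OF R[of x], of c]
        by (intro unique[OF R]) (simp add: scaleC_add_right scaleC_scaleC mult.commute)
    qed
  qed
qed

subsection \<open>Boundary triplets in Cayley form\<close>

lemma unitary_opD:
  assumes "unitary_op U"
  shows "clinear U" "surj U" "cinner (U x) (U y) = cinner x y" "norm (U x) = norm x"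
proof -
  show *: "cinner (U x) (U y) = cinner x y" for x y using assms by (simp add: unitary_op_def)
  show "norm (U x) = norm x"
    using *[of x x] by (simp add: norm_eq_sqrt_inner inner_eq_Re_cinner)
qed (use assms in \<open>auto simp: unitary_op_def\<close>)

locale cayley_boundary_triplet =
  fixes T :: "'h::chilbert_space operator" and p q :: "'h \<Rightarrow> 'g::chilbert_space"
  assumes dense: "densely_defined T"
    and sym: "symmetric_operator T"
    and p_lin: "clinear_on (Domain (adjoint_op T)) p"
    and q_lin: "clinear_on (Domain (adjoint_op T)) q"
    and surj: "\<And>g h. \<exists>x\<in>Domain (adjoint_op T). p x = g \<and> q x = h"
    and green: "\<And>x u y v. (x, u) \<in> adjoint_op T \<Longrightarrow> (y, v) \<in> adjoint_op T \<Longrightarrow>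
      cinner u y - cinner x v = (\<i> / 2) * (cinner (p x) (p y) - cinner (q x) (q y))"
begin

abbreviation M where "M \<equiv> adjoint_op T"

definition ext :: "('g \<Rightarrow> 'g) \<Rightarrow> 'h operator"
  where "ext U = {(x, u). (x, u) \<in> M \<and> q x = U (p x)}"

lemmas M_zero = subspace_operatorD(1)[OF subspace_adjoint_op, of T]
lemmas M_add = subspace_operatorD(2)[OF subspace_adjoint_op, of _ _ T]
lemmas M_scale = subspace_operatorD(3)[OF subspace_adjoint_op, of _ _ T]
lemmas M_diff = subspace_operatorD(4)[OF subspace_adjoint_op, of _ _ T]

lemma pq_add:
  assumes "(x, u) \<in> M" "(y, v) \<in> M"
  shows "p (x + y) = p x + p y" "q (x + y) = q x + q y"
  using p_lin q_lin DomainI[OF assms(1)] DomainI[OF assms(2)] unfolding clinear_on_def by blast+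

lemma pq_scale:
  assumes "(x, u) \<in> M"
  shows "p (c *\<^sub>C x) = c *\<^sub>C p x" "q (c *\<^sub>C x) = c *\<^sub>C q x"
  using p_lin q_lin DomainI[OF assms] unfolding clinear_on_def by blast+

lemma pq_diff:
  assumes "(x, u) \<in> M" "(y, v) \<in> M"
  shows "p (x - y) = p x - p y" "q (x - y) = q x - q y"
  using pq_add[OF M_diff[OF assms] assms(2)] by simp_all

lemma pq_zero: "p 0 = 0" "q 0 = 0"
  using pq_diff[OF M_zero M_zero] by simp_all

lemma M_single_valued: "(x, u) \<in> M \<Longrightarrow> (x, v) \<in> M \<Longrightarrow> u = v"
proof -
  assume uv: "(x, u) \<in> M" "(x, v) \<in> M"
  have "u - v = 0"
  proof (rule cinner_eq_0_denseD)
    show "closure (Domain T) = UNIV" using dense by (simp add: densely_defined_def)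
    show "cinner y (u - v) = 0" if "y \<in> Domain T" for y
    proof -
      from that obtain w where "(y, w) \<in> T" by blast
      then show ?thesis
        by (simp add: cinner_diff_right flip: adjoint_opD[OF uv(1)] adjoint_opD[OF uv(2)])
    qed
  qed
  then show ?thesis by simp
qed

lemma T_subset_M: "T \<subseteq> M"
  using sym by (fastforce simp: symmetric_operator_def adjoint_op_def)

lemma M_surj: obtains x u where "(x, u) \<in> M" "p x = g" "q x = h"
  using surj[of g h] by blast

text \<open>Green's form is nondegenerate because the boundary map is onto: testing with the errors
  in \<open>p\<close> and \<open>q\<close>, the second with reversed sign, turns the indefinite form
  into a sum of squares. Boundary values can thus be identified weakly, before continuity of
  \<open>p\<close> and \<open>q\<close> is known.\<close>

lemma boundary_values_eqI:
  assumes x: "(x, u) \<in> M"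
    and eq: "\<And>y v. (y, v) \<in> M \<Longrightarrow>
      cinner u y - cinner x v = (\<i> / 2) * (cinner g (p y) - cinner h (q y))"
  shows "p x = g" "q x = h"
proof -
  obtain y v where y: "(y, v) \<in> M" "p y = p x - g" "q y = - (q x - h)" using M_surj by blast
  have "(\<i> / 2) * (cinner (p x) (p y) - cinner (q x) (q y))
      = (\<i> / 2) * (cinner g (p y) - cinner h (q y))"
    using eq[OF y(1)] green[OF x y(1)] by (simp only:)
  then have "cinner (p x) (p y) - cinner (q x) (q y) = cinner g (p y) - cinner h (q y)"
    by (simp only: mult_cancel_left) simp
  then have "cinner (p x - g) (p y) - cinner (q x - h) (q y) = 0"
    by (simp add: cinner_diff_left algebra_simps)
  then have "complex_of_real ((norm (p x - g))\<^sup>2 + (norm (q x - h))\<^sup>2) = 0"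
    using y(2,3) by (simp only: cinner_minus_right cinner_self of_real_add) simp
  then have "(norm (p x - g))\<^sup>2 + (norm (q x - h))\<^sup>2 = 0" by (simp only: of_real_eq_0_iff)
  then show "p x = g" "q x = h" by (simp_all add: add_nonneg_eq_0_iff)
qed

lemma boundary_values_T:
  assumes "(x, u) \<in> T"
  shows "p x = 0" "q x = 0"
proof -
  have x: "(x, u) \<in> M" using assms T_subset_M by blast
  have "cinner u y - cinner x v = (\<i> / 2) * (cinner 0 (p y) - cinner 0 (q y))"
    if "(y, v) \<in> M" for y v
    using adjoint_opD[OF that assms] by simp
  then show "p x = 0" "q x = 0" using boundary_values_eqI[OF x] by blast+
qed

text \<open>
  The right inverse comes from the open mapping theorem. Green's identity for \<open>x\<close> and a preimage
  \<open>y\<close> of \<open>(p x, - q x)\<close> then bounds \<open>p\<close> and \<open>q\<close>, without the closed graph theorem.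
\<close>

lemma boundary_map_bounds:
  obtains C where "C > 0"
    "\<And>x u. (x, u) \<in> M \<Longrightarrow> norm (p x) + norm (q x) \<le> C * (norm x + norm u)"
    "\<And>g h. \<exists>x u. (x, u) \<in> M \<and> p x = g \<and> q x = h \<and>
      norm x + norm u \<le> C * (norm g + norm h)"
proof -
  \<comment> \<open>\<open>L\<close> is the multivalued inverse of the boundary map. Working with a
    relation avoids factoring out the kernel of that map.\<close>
  define L where "L = {w :: ('g \<times> 'g) \<times> ('h \<times> 'h).
    snd w \<in> M \<and> p (fst (snd w)) = fst (fst w) \<and> q (fst (snd w)) = snd (fst w)}"
  have L_iff: "((g, h), (x, u)) \<in> L \<longleftrightarrow> (x, u) \<in> M \<and> p x = g \<and> q x = h" for g h x u
    by (simp add: L_def)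
  have "subspace L"
    unfolding subspace_def
  proof (intro conjI ballI allI)
    show "0 \<in> L" using M_zero pq_zero by (simp add: L_def zero_prod_def)
  next
    fix v w assume "v \<in> L" "w \<in> L"
    then show "v + w \<in> L"
      using M_add pq_add by (cases v, cases w) (auto simp: L_iff)
  next
    fix c v assume "v \<in> L"
    then show "c *\<^sub>R v \<in> L"
      using M_scale[where c = "complex_of_real c"] pq_scale[where c = "complex_of_real c"]
      by (cases v) (auto simp: L_iff simp flip: scaleR_scaleC)
  qed
  moreover have "closed L"
    unfolding closed_sequential_limits
  proof (intro allI impI, elim conjE)
    fix f l assume f: "\<forall>n. f n \<in> L" "f \<longlonglongrightarrow> l"
    obtain g h x u where l: "l = ((g, h), (x, u))" by (metis surj_pair)
    have M: "(x, u) \<in> M"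
    proof (rule closed_sequentially[OF closed_adjoint_op])
      show "snd (f n) \<in> M" for n using f(1) by (simp add: L_def)
      show "(\<lambda>n. snd (f n)) \<longlonglongrightarrow> (x, u)" using tendsto_snd[OF f(2)] l by simp
    qed
    have lim: "(\<lambda>n. fst (fst (f n))) \<longlonglongrightarrow> g" "(\<lambda>n. snd (fst (f n))) \<longlonglongrightarrow> h"
      "(\<lambda>n. fst (snd (f n))) \<longlonglongrightarrow> x" "(\<lambda>n. snd (snd (f n))) \<longlonglongrightarrow> u"
      using tendsto_fst[OF tendsto_fst[OF f(2)]] tendsto_snd[OF tendsto_fst[OF f(2)]]
        tendsto_fst[OF tendsto_snd[OF f(2)]] tendsto_snd[OF tendsto_snd[OF f(2)]]
      by (simp_all add: l)
    \<comment> \<open>Green's identity against a fixed \<open>y\<close> passes to the limit, and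
      \<open>boundary_values_eqI\<close> then recognizes \<open>g\<close> and \<open>h\<close> as
      the boundary values of \<open>x\<close>.\<close>
    have "cinner u y - cinner x v = (\<i> / 2) * (cinner g (p y) - cinner h (q y))"
      if yv: "(y, v) \<in> M" for y v
    proof (rule LIMSEQ_unique)
      show "(\<lambda>n. cinner (snd (snd (f n))) y - cinner (fst (snd (f n))) v)
          \<longlonglongrightarrow> cinner u y - cinner x v"
        by (intro tendsto_diff tendsto_cinner lim tendsto_const)
      have "cinner (snd (snd (f n))) y - cinner (fst (snd (f n))) v
          = (\<i> / 2) * (cinner (fst (fst (f n))) (p y) - cinner (snd (fst (f n))) (q y))" for n
        using f(1) green[OF _ yv, of "fst (snd (f n))" "snd (snd (f n))"] by (simp add: L_def)
      then show "(\<lambda>n. cinner (snd (snd (f n))) y - cinner (fst (snd (f n))) v)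
          \<longlonglongrightarrow> (\<i> / 2) * (cinner g (p y) - cinner h (q y))"
        by (simp only:) (intro tendsto_mult tendsto_diff tendsto_cinner lim tendsto_const)
    qed
    from boundary_values_eqI[OF M this] show "l \<in> L" using M by (simp add: l L_iff)
  qed
  moreover have "Domain L = UNIV"
  proof -
    have "(g, h) \<in> Domain L" for g h
    proof -
      obtain x u where "(x, u) \<in> M" "p x = g" "q x = h" using M_surj by blast
      then have "((g, h), (x, u)) \<in> L" by (simp add: L_iff)
      then show ?thesis by (rule DomainI)
    qed
    then show ?thesis by (metis UNIV_eq_I surj_pair)
  qed
  ultimately obtain C where C: "C > 0" "\<And>w. \<exists>z. (w, z) \<in> L \<and> norm z \<le> C * norm w"
    using closed_relation_bounded_section by blast
  have sec: "\<exists>x u. (x, u) \<in> M \<and> p x = g \<and> q x = h \<and>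
      norm x + norm u \<le> (2 * C) * (norm g + norm h)" for g h
  proof -
    obtain x u where xu: "((g, h), (x, u)) \<in> L" "norm (x, u) \<le> C * norm (g, h)"
      using C(2)[of "(g, h)"] by (metis surj_pair)
    have "C * norm (g, h) \<le> C * (norm g + norm h)"
      using C(1) norm_Pair_le[of g h] by simp
    moreover have "norm x \<le> norm (x, u)" "norm u \<le> norm (x, u)"
      using norm_fst_le[of x u] norm_snd_le[of u x] by simp_all
    ultimately have "norm x + norm u \<le> (2 * C) * (norm g + norm h)" using xu(2) by simp
    then show ?thesis using xu(1) L_iff by blast
  qed
  have bdd: "norm (p x) + norm (q x) \<le> (8 * C) * (norm x + norm u)" if xu: "(x, u) \<in> M" for x u
  proof -
    obtain y v where y: "(y, v) \<in> M" "p y = p x" "q y = - q x"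
      "norm y + norm v \<le> (2 * C) * (norm (p x) + norm (q x))"
      using sec[of "p x" "- q x"] by auto
    let ?s = "norm (p x) + norm (q x)"
    have "cinner u y - cinner x v
        = (\<i> / 2) * complex_of_real ((norm (p x))\<^sup>2 + (norm (q x))\<^sup>2)"
      using green[OF xu y(1)] y by (simp add: cinner_self)
    then have "cmod (cinner u y - cinner x v) = ((norm (p x))\<^sup>2 + (norm (q x))\<^sup>2) / 2"
      by (simp only: norm_mult norm_of_real) (simp add: norm_divide)
    moreover have "cmod (cinner u y - cinner x v) \<le> norm u * norm y + norm x * norm v"
      using norm_triangle_ineq4[of "cinner u y" "cinner x v"] norm_cinner_le[of u y]
        norm_cinner_le[of x v] by linarith
    moreover have "norm u * norm y + norm x * norm v \<le> (norm x + norm u) * (norm y + norm v)"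
      by (simp add: algebra_simps)
    moreover have "\<dots> \<le> (norm x + norm u) * ((2 * C) * ?s)"
      by (intro mult_left_mono y) simp
    moreover have "?s\<^sup>2 \<le> 2 * ((norm (p x))\<^sup>2 + (norm (q x))\<^sup>2)"
      using sum_squares_bound[of "norm (p x)" "norm (q x)"] by (simp add: power2_sum)
    \<comment> \<open>One factor 2 undoes the halving in Green's identity, another compares the
      square of the sum with the sum of squares. Together with \<open>2 * C\<close> from the section
      they yield \<open>8 * C\<close> once a factor \<open>?s\<close> is cancelled.\<close>
    ultimately have "?s\<^sup>2 \<le> 4 * ((norm x + norm u) * ((2 * C) * ?s))" by linarith
    then have "?s * ?s \<le> ((8 * C) * (norm x + norm u)) * ?s"
      by (simp add: power2_eq_square algebra_simps)
    moreover have "0 \<le> (8 * C) * (norm x + norm u)" using C(1) by simp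
    moreover have "?s \<ge> 0" by simp
    ultimately show ?thesis by (metis mult_right_le_imp_le order_le_less)
  qed
  show thesis
  proof (rule that[of "8 * C"])
    show "\<exists>x u. (x, u) \<in> M \<and> p x = g \<and> q x = h \<and>
        norm x + norm u \<le> 8 * C * (norm g + norm h)" for g h
    proof -
      have "(2 * C) * (norm g + norm h) \<le> (8 * C) * (norm g + norm h)"
        using C(1) by (intro mult_right_mono) auto
      with sec[of g h] show ?thesis using order_trans by blast
    qed
  qed (use C(1) bdd in auto)
qed

section \<open>Self-adjoint extensions and unitary operators\<close>

lemma ext_iff: "(x, u) \<in> ext U \<longleftrightarrow> (x, u) \<in> M \<and> q x = U (p x)"
  by (simp add: ext_def)

lemma subspace_ext: "clinear U \<Longrightarrow> complex_vector.subspace (ext U)"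
  by (intro subspace_operatorI)
    (auto simp: ext_iff clinear_0 M_zero pq_zero M_add pq_add M_scale pq_scale clinear_iff)

lemma self_adjoint_extension_ext:
  assumes "unitary_op U"
  shows "self_adjoint_extension T (ext U)"
proof -
  note U = unitary_opD[OF assms]
  have T_ext: "T \<subseteq> ext U"
  proof (rule subrelI)
    fix x u assume "(x, u) \<in> T"
    then show "(x, u) \<in> ext U"
      using T_subset_M boundary_values_T clinear_0[OF U(1)] by (auto simp: ext_iff)
  qed
  have ext_M: "ext U \<subseteq> M" by (auto simp: ext_def)
  have "adjoint_op (ext U) = ext U"
  proof (rule antisym; rule subrelI)
    fix y v assume yv: "(y, v) \<in> ext U"
    show "(y, v) \<in> adjoint_op (ext U)"
    proof (rule adjoint_opI)
      fix x u assume "(x, u) \<in> ext U"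
      then show "cinner u y = cinner x v"
        using green[of x u y v] yv by (simp add: ext_iff U)
    qed
  next
    fix y v assume yv: "(y, v) \<in> adjoint_op (ext U)"
    then have M: "(y, v) \<in> M" using T_ext by (auto simp: adjoint_op_def)
    obtain c where c: "q y = U c" using U(2) by (metis surjD)
    \<comment> \<open>As \<open>q y = U c\<close>, membership of \<open>(y, v)\<close> in
      \<open>ext U\<close> amounts to \<open>p y = c\<close>. The test element has exactly the error
      \<open>p y - c\<close> as its \<open>p\<close>-value, so Green's identity returns the squared
      norm of that error.\<close>
    obtain x u where x: "(x, u) \<in> M" "p x = p y - c" "q x = U (p y - c)" using M_surj by blast
    then have "cinner u y = cinner x v"
      by (intro adjoint_opD[OF yv]) (simp add: ext_iff)
    then have "cinner (p y - c) (p y - c) = 0"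
      using green[OF x(1) M] by (simp add: x c U cinner_diff_right)
    then show "(y, v) \<in> ext U" using M c by (simp add: ext_iff cinner_self)
  qed
  moreover have "linear_operator (ext U)"
    unfolding linear_operator_def
  proof
    show "single_valued (ext U)"
      using M_single_valued ext_M by (intro single_valuedI) blast
  qed (rule subspace_ext[OF U(1)])
  moreover have "densely_defined (ext U)"
    using dense closure_mono[OF Domain_mono[OF T_ext]] by (auto simp: densely_defined_def)
  ultimately show ?thesis using T_ext ext_M
    by (simp add: self_adjoint_extension_def self_adjoint_def)
qed

lemma ext_inject: "ext U = ext V \<Longrightarrow> U = V"
proof
  fix g assume eq: "ext U = ext V"
  obtain x u where x: "(x, u) \<in> M" "p x = g" "q x = U g" using M_surj by blast
  then have "(x, u) \<in> ext U" by (simp add: ext_iff)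
  then have "(x, u) \<in> ext V" using eq by simp
  then show "U g = V g" using x by (simp add: ext_iff)
qed

end

text \<open>Maximality makes the domain of an isometric relation both closed and dense.\<close>

lemma maximal_isometric_relation_Domain:
  fixes \<Theta> :: "('g::chilbert_space \<times> 'g) set"
  assumes sub: "complex_vector.subspace \<Theta>"
    and iso: "\<And>g h g' h'. (g, h) \<in> \<Theta> \<Longrightarrow> (g', h') \<in> \<Theta> \<Longrightarrow> cinner g g' = cinner h h'"
    and max: "\<And>g' h'. (\<And>g h. (g, h) \<in> \<Theta> \<Longrightarrow> cinner g g' = cinner h h') \<Longrightarrow> (g', h') \<in> \<Theta>"
  shows "Domain \<Theta> = UNIV"
proof (rule closed_csubspace_eq_UNIVI)
  note sub' = subspace_operatorD[OF sub]
  show "complex_vector.subspace (Domain \<Theta>)"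
    unfolding complex_vector.subspace_def using sub'(1-3) by blast
  show "closed (Domain \<Theta>)"
    unfolding closed_sequential_limits
  proof (intro allI impI, elim conjE)
    fix f l assume f: "\<forall>n. f n \<in> Domain \<Theta>" "f \<longlonglongrightarrow> l"
    then obtain k where k: "\<And>n. (f n, k n) \<in> \<Theta>" unfolding Domain_iff by metis
    have eq: "norm (k m - k n) = norm (f m - f n)" for m n
      using iso[OF sub'(4)[OF k k] sub'(4)[OF k k]]
      by (simp add: norm_eq_sqrt_inner inner_eq_Re_cinner)
    have "Cauchy k"
      using LIMSEQ_imp_Cauchy[OF f(2)] unfolding Cauchy_def dist_norm eq .
    then obtain h where h: "k \<longlonglongrightarrow> h" using Cauchy_convergent convergent_def by blast
    \<comment> \<open>Compatibility with every pair of \<open>\<Theta>\<close> survives limits, so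
      maximality makes \<open>\<Theta>\<close> closed.\<close>
    have "(l, h) \<in> \<Theta>"
    proof (rule max)
      fix g' h' assume "(g', h') \<in> \<Theta>"
      then have "(\<lambda>n. cinner g' (f n)) = (\<lambda>n. cinner h' (k n))" using iso k by blast
      moreover have "(\<lambda>n. cinner g' (f n)) \<longlonglongrightarrow> cinner g' l"
        by (intro tendsto_cinner tendsto_const f)
      moreover have "(\<lambda>n. cinner h' (k n)) \<longlonglongrightarrow> cinner h' h"
        by (intro tendsto_cinner tendsto_const h)
      ultimately show "cinner g' l = cinner h' h" by (simp add: LIMSEQ_unique)
    qed
    then show "l \<in> Domain \<Theta>" by blast
  qed
next
  fix z assume z: "\<And>s. s \<in> Domain \<Theta> \<Longrightarrow> cinner s z = 0"
  \<comment> \<open>Orthogonality to the domain is precisely what the maximality test asks of the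
    pair \<open>(z, 0)\<close>. Isometry then forces \<open>z\<close> and 0 to have equal
    norms.\<close>
  have "(z, 0) \<in> \<Theta>" by (rule max) (use z in auto)
  then show "z = 0" using iso[of z 0 z 0] by (simp add: cinner_self)
qed

text \<open>Both assumptions are symmetric under taking converses, so the totality result applies to
  \<open>\<Theta>\<close> and to its converse, giving full domain and full range. Isometry makes
  \<open>\<Theta>\<close> single-valued.\<close>

lemma maximal_isometric_relation_unitary:
  fixes \<Theta> :: "('g::chilbert_space \<times> 'g) set"
  assumes sub: "complex_vector.subspace \<Theta>"
    and iso: "\<And>g h g' h'. (g, h) \<in> \<Theta> \<Longrightarrow> (g', h') \<in> \<Theta> \<Longrightarrow> cinner g g' = cinner h h'"
    and max: "\<And>g' h'. (\<And>g h. (g, h) \<in> \<Theta> \<Longrightarrow> cinner g g' = cinner h h') \<Longrightarrow> (g', h') \<in> \<Theta>"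
  obtains U where "unitary_op U" "\<And>g h. (g, h) \<in> \<Theta> \<longleftrightarrow> h = U g"
proof -
  note sub' = subspace_operatorD[OF sub]
  have "Domain \<Theta> = UNIV" by (rule maximal_isometric_relation_Domain[OF sub iso max])
  then have "\<forall>g. \<exists>h. (g, h) \<in> \<Theta>" by blast
  then obtain U where U: "\<And>g. (g, U g) \<in> \<Theta>" by metis
  have unique: "h = h'" if "(g, h) \<in> \<Theta>" "(g, h') \<in> \<Theta>" for g h h'
  proof -
    have "(0, h - h') \<in> \<Theta>" using sub'(4)[OF that] by simp
    from iso[OF this this] show ?thesis by (simp add: cinner_self)
  qed
  have "Domain (\<Theta>\<inverse>) = UNIV"
  proof (rule maximal_isometric_relation_Domain)
    show "complex_vector.subspace (\<Theta>\<inverse>)"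
      by (rule subspace_operatorI) (auto simp: sub')
    show "cinner g g' = cinner h h'" if "(g, h) \<in> \<Theta>\<inverse>" "(g', h') \<in> \<Theta>\<inverse>" for g h g' h'
      using iso[of h g h' g'] that by simp
    show "(g', h') \<in> \<Theta>\<inverse>" if "\<And>g h. (g, h) \<in> \<Theta>\<inverse> \<Longrightarrow> cinner g g' = cinner h h'" for g' h'
    proof -
      have "(h', g') \<in> \<Theta>"
      proof (rule max)
        fix g h assume "(g, h) \<in> \<Theta>"
        then have "(h, g) \<in> \<Theta>\<inverse>" by simp
        from that[OF this] show "cinner g h' = cinner h g'" by simp
      qed
      then show ?thesis by simp
    qed
  qed
  then have range: "\<exists>g. (g, h) \<in> \<Theta>" for h by blast
  have "surj U"
  proof (rule surjI)
    show "U (SOME g. (g, h) \<in> \<Theta>) = h" for h using unique[OF U someI_ex[OF range]] .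
  qed
  moreover have "clinear U" unfolding clinear_iff
    using unique[OF U] sub'(2)[OF U U] sub'(3)[OF U] by blast
  moreover have "cinner (U g) (U g') = cinner g g'" for g g'
    using iso[OF U U] by simp
  ultimately have "unitary_op U" by (simp add: unitary_op_def)
  then show thesis using that U unique by blast
qed

context cayley_boundary_triplet
begin

text \<open>Green's identity translates \<open>adjoint_op A = A\<close> into a statement on boundary
  values: symmetry of \<open>A\<close> makes \<open>\<Theta>\<close> isometric, and the inclusion of
  the adjoint in \<open>A\<close> makes it maximal.\<close>

lemma self_adjoint_extension_imp_ext:
  assumes "self_adjoint_extension T A"
  obtains U where "unitary_op U" "A = ext U"
proof -
  have AM: "A \<subseteq> M" and A: "adjoint_op A = A" and sub: "complex_vector.subspace A"
    using assms by (auto simp: self_adjoint_extension_def self_adjoint_def linear_operator_def)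
  note sub' = subspace_operatorD[OF sub]
  define \<Theta> where "\<Theta> = {(p x, q x) | x u. (x, u) \<in> A}"
  have \<Theta>I: "(p x, q x) \<in> \<Theta>" if "(x, u) \<in> A" for x u using that by (auto simp: \<Theta>_def)
  \<comment> \<open>This yields maximality of \<open>\<Theta>\<close> and also shows that membership
    in \<open>A\<close> depends on boundary values alone, which gives the inclusion of
    \<open>ext U\<close> in \<open>A\<close>.\<close>
  have memI: "(y, v) \<in> A"
    if "(y, v) \<in> M" "\<And>g h. (g, h) \<in> \<Theta> \<Longrightarrow> cinner g (p y) = cinner h (q y)" for y v
  proof -
    have "(y, v) \<in> adjoint_op A"
    proof (rule adjoint_opI)
      fix x u assume x: "(x, u) \<in> A"
      then have "(x, u) \<in> M" using AM by blast
      from green[OF this that(1)] show "cinner u y = cinner x v" using that(2)[OF \<Theta>I[OF x]] by simp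
    qed
    then show ?thesis using A by simp
  qed
  have sub_\<Theta>: "complex_vector.subspace \<Theta>"
  proof (rule subspace_operatorI)
    show "(0, 0) \<in> \<Theta>" using \<Theta>I[OF sub'(1)] pq_zero by simp
    show "(g + g', h + h') \<in> \<Theta>" if gh: "(g, h) \<in> \<Theta>" "(g', h') \<in> \<Theta>" for g h g' h'
    proof -
      obtain x u y v where "(x, u) \<in> A" "g = p x" "h = q x" "(y, v) \<in> A" "g' = p y" "h' = q y"
        using gh by (auto simp: \<Theta>_def)
      then show ?thesis using \<Theta>I[OF sub'(2)] pq_add AM by (metis subsetD)
    qed
    show "(c *\<^sub>C g, c *\<^sub>C h) \<in> \<Theta>" if gh: "(g, h) \<in> \<Theta>" for c g h
    proof -
      obtain x u where "(x, u) \<in> A" "g = p x" "h = q x" using gh by (auto simp: \<Theta>_def)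
      then show ?thesis using \<Theta>I[OF sub'(3)] pq_scale AM by (metis subsetD)
    qed
  qed
  have iso: "cinner g g' = cinner h h'" if gh: "(g, h) \<in> \<Theta>" "(g', h') \<in> \<Theta>" for g h g' h'
  proof -
    obtain x u y v where xy: "(x, u) \<in> A" "g = p x" "h = q x" "(y, v) \<in> A" "g' = p y" "h' = q y"
      using gh by (auto simp: \<Theta>_def)
    have "cinner u y = cinner x v" using adjoint_opD[of y v A x u] xy A by simp
    then show ?thesis using green[of x u y v] xy AM by auto
  qed
  have max: "(g', h') \<in> \<Theta>" if "\<And>g h. (g, h) \<in> \<Theta> \<Longrightarrow> cinner g g' = cinner h h'" for g' h'
  proof -
    obtain y v where y: "(y, v) \<in> M" "p y = g'" "q y = h'" using M_surj by blast
    have "(y, v) \<in> A" by (rule memI[OF y(1)]) (simp add: y that)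
    from \<Theta>I[OF this] show ?thesis by (simp add: y)
  qed
  obtain U where U: "unitary_op U" "\<And>g h. (g, h) \<in> \<Theta> \<longleftrightarrow> h = U g"
    using maximal_isometric_relation_unitary[OF sub_\<Theta> iso max] by blast
  have "A = ext U"
  proof (rule antisym; rule subrelI)
    fix x u assume "(x, u) \<in> A"
    then show "(x, u) \<in> ext U" using \<Theta>I AM U(2) by (auto simp: ext_iff)
  next
    fix x u assume xu: "(x, u) \<in> ext U"
    then have "(p x, q x) \<in> \<Theta>" by (simp add: ext_iff U(2))
    then show "(x, u) \<in> A" using xu iso by (intro memI) (auto simp: ext_iff)
  qed
  with U(1) show thesis using that by blast
qed

section \<open>Compactness of resolvents and differences of unitaries\<close>

text \<open>The composite of \<open>V\<close> with \<open>p\<close>, minus \<open>q\<close>,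
  vanishes on the domain of \<open>ext V\<close>. It therefore does not see \<open>S f\<close> and
  sends \<open>R f - S f\<close> to \<open>V - U\<close> applied to \<open>p (R f)\<close>.\<close>

lemma compact_resolvent_ext_iff:
  assumes U: "unitary_op U" and V: "unitary_op V" and cpt: "compact_resolvent (ext V)"
  shows "compact_resolvent (ext U) \<longleftrightarrow> compact_op (\<lambda>g. U g - V g)"
proof -
  note U' = unitary_opD[OF U] and V' = unitary_opD[OF V]
  obtain S where S: "compact_op S" "\<And>x y. (x, y + \<i> *\<^sub>C x) \<in> ext V \<longleftrightarrow> x = S y"
    using cpt unfolding compact_resolvent_def resolvent_graph_iff by blast
  have S_lin: "clinear S" using S(1) by (simp add: compact_op_def)
  obtain c where c: "c > 0" "\<And>y. norm (S y) \<le> c * norm y" using compact_op_bound[OF S(1)] by blast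
  obtain C where C: "C > 0"
    "\<And>x u. (x, u) \<in> M \<Longrightarrow> norm (p x) + norm (q x) \<le> C * (norm x + norm u)"
    "\<And>g h. \<exists>x u. (x, u) \<in> M \<and> p x = g \<and> q x = h \<and>
      norm x + norm u \<le> C * (norm g + norm h)"
    using boundary_map_bounds by blast
  \<comment> \<open>Both \<open>x\<close> and \<open>S f\<close> solve the equation with right-hand
    side \<open>f\<close> for the adjoint of \<open>T\<close> shifted by \<open>\<i>\<close>, so
    their difference lies in the deficiency space.\<close>
  have defect: "(x - S f, \<i> *\<^sub>C (x - S f)) \<in> M"
    "V (p (x - S f)) - q (x - S f) = V (p x) - q x"
    if x: "(x, f + \<i> *\<^sub>C x) \<in> M" for x f
  proof -
    have "(S f, f + \<i> *\<^sub>C S f) \<in> ext V" using S(2) by simp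
    then have Sf: "(S f, f + \<i> *\<^sub>C S f) \<in> M" "q (S f) = V (p (S f))" by (simp_all add: ext_iff)
    show "(x - S f, \<i> *\<^sub>C (x - S f)) \<in> M"
      using M_diff[OF x Sf(1)] by (simp add: scaleC_diff_right)
    show "V (p (x - S f)) - q (x - S f) = V (p x) - q x"
      using pq_diff[OF x Sf(1)] Sf(2) by (simp add: clinear_diff[OF V'(1)])
  qed
  have upper: "norm (V (p n) - q n) \<le> 2 * C * norm n" if n: "(n, \<i> *\<^sub>C n) \<in> M" for n
    using C(2)[OF n] norm_triangle_ineq4[of "V (p n)" "q n"] by (simp add: V'(4))
  define K where "K = (1 + c) * C"
  have K: "K > 0" using c C by (simp add: K_def)
  \<comment> \<open>A correction \<open>y\<close> carrying the boundary error \<open>?d\<close>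
    moves \<open>n\<close> into the domain of \<open>ext V\<close>. There the bounded resolvent
    \<open>S\<close> recovers \<open>n - y\<close> from \<open>y\<close> and \<open>v\<close>, whose
    norms are controlled by that of \<open>?d\<close>.\<close>
  have lower: "norm n \<le> K * norm (V (p n) - q n)" if n: "(n, \<i> *\<^sub>C n) \<in> M" for n
  proof -
    let ?d = "V (p n) - q n"
    obtain y v where y: "(y, v) \<in> M" "p y = 0" "q y = - ?d" "norm y + norm v \<le> C * norm ?d"
      using C(3)[of 0 "- ?d"] unfolding norm_minus_cancel norm_zero by auto
    have "(n - y, \<i> *\<^sub>C n - v) \<in> ext V"
      using M_diff[OF n y(1)] pq_diff[OF n y(1)] y by (simp add: ext_iff)
    then have "(n - y, (\<i> *\<^sub>C y - v) + \<i> *\<^sub>C (n - y)) \<in> ext V"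
      by (simp add: scaleC_diff_right)
    then have "n - y = S (\<i> *\<^sub>C y - v)" by (simp only: S(2))
    then have "n = y + S (\<i> *\<^sub>C y - v)" by (simp only: diff_eq_eq add.commute)
    then have "norm n \<le> norm y + c * norm (\<i> *\<^sub>C y - v)"
      using norm_triangle_ineq[of y "S (\<i> *\<^sub>C y - v)"] c(2)[of "\<i> *\<^sub>C y - v"] by simp
    also have "\<dots> \<le> (norm y + norm v) + c * (norm y + norm v)"
      using norm_triangle_ineq4[of "\<i> *\<^sub>C y" v] c(1) by (intro add_mono mult_left_mono) auto
    also have "\<dots> = (1 + c) * (norm y + norm v)" by (simp add: algebra_simps)
    also have "\<dots> \<le> (1 + c) * (C * norm ?d)" using y(4) c(1) by (intro mult_left_mono) auto
    finally show ?thesis by (simp add: K_def mult.assoc)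
  qed
  show ?thesis
  proof
    assume "compact_resolvent (ext U)"
    then obtain R where R: "compact_op R" "\<And>x y. (x, y + \<i> *\<^sub>C x) \<in> ext U \<longleftrightarrow> x = R y"
      unfolding compact_resolvent_def resolvent_graph_iff by blast
    have R_lin: "clinear R" using R(1) by (simp add: compact_op_def)
    have "\<exists>f. p (R f) = g \<and> norm f \<le> (2 * C) * norm g" for g
    proof -
      \<comment> \<open>The boundary values \<open>g\<close> and \<open>U g\<close> place
        \<open>x\<close> in the domain of \<open>ext U\<close>, so \<open>f\<close> can be read off
        as \<open>u - \<i> *\<^sub>C x\<close>.\<close>
      obtain x u where x: "(x, u) \<in> M" "p x = g" "q x = U g" "norm x + norm u \<le> C * (norm g + norm g)"
        using C(3)[of g "U g"] U'(4) by auto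
      have "(x, (u - \<i> *\<^sub>C x) + \<i> *\<^sub>C x) \<in> ext U" using x by (simp add: ext_iff)
      then have "x = R (u - \<i> *\<^sub>C x)" by (simp only: R(2))
      moreover have "norm (u - \<i> *\<^sub>C x) \<le> (2 * C) * norm g"
        using norm_triangle_ineq4[of u "\<i> *\<^sub>C x"] x(4) by simp
      ultimately show ?thesis using x(2) by metis
    qed
    then obtain \<phi> where \<phi>: "\<And>g. p (R (\<phi> g)) = g" "\<And>g. norm (\<phi> g) \<le> (2 * C) * norm g" by metis
    show "compact_op (\<lambda>g. U g - V g)"
    proof (rule compact_op_dominated[OF _ R(1) S(1) \<phi>(2) \<phi>(2)])
      show "clinear (\<lambda>g. U g - V g)"
        using U'(1) V'(1) by (simp add: clinear_iff scaleC_diff_right)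
      fix g g'
      let ?f = "\<phi> g - \<phi> g'"
      have "(R f, f + \<i> *\<^sub>C R f) \<in> ext U" for f using R(2) by simp
      then have ext: "(R f, f + \<i> *\<^sub>C R f) \<in> M" "q (R f) = U (p (R f))" for f
        by (simp_all add: ext_iff)
      \<comment> \<open>Although \<open>\<phi>\<close> is chosen pointwise and may fail to be
        additive, linearity of \<open>R\<close> and additivity of \<open>p\<close> still give the
        difference of boundary values.\<close>
      have pR: "p (R ?f) = g - g'"
        using pq_diff(1)[OF ext(1) ext(1), of "\<phi> g" "\<phi> g'"] by (simp add: clinear_diff[OF R_lin] \<phi>(1))
      have "norm ((U g - V g) - (U g' - V g')) = norm (V (p (R ?f)) - q (R ?f))"
        unfolding ext(2) pR clinear_diff[OF U'(1)] clinear_diff[OF V'(1)]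
        by (subst norm_minus_commute) (simp add: algebra_simps)
      also have "\<dots> \<le> 2 * C * norm (R ?f - S ?f)"
        using upper[OF defect(1)[OF ext(1)]] defect(2)[OF ext(1)] by simp
      also have "R ?f - S ?f = (R (\<phi> g) - R (\<phi> g')) - (S (\<phi> g) - S (\<phi> g'))"
        by (simp add: clinear_diff[OF R_lin] clinear_diff[OF S_lin])
      also have "2 * C * norm \<dots>
          \<le> 2 * C * (norm (R (\<phi> g) - R (\<phi> g')) + norm (S (\<phi> g) - S (\<phi> g')))"
        using C(1) by (intro mult_left_mono norm_triangle_ineq4) simp
      finally show "norm ((U g - V g) - (U g' - V g'))
          \<le> 2 * C * (norm (R (\<phi> g) - R (\<phi> g')) + norm (S (\<phi> g) - S (\<phi> g')))" .
    qed
  next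
    assume UV: "compact_op (\<lambda>g. U g - V g)"
    \<comment> \<open>Self-adjointness already supplies a contractive resolvent, so only its
      compactness remains.\<close>
    have "self_adjoint (ext U)"
      using self_adjoint_extension_ext[OF U] by (simp add: self_adjoint_extension_def)
    then obtain R where R_lin: "clinear R" and R_le: "\<And>y. norm (R y) \<le> norm y"
      and R: "(shift_op (ext U) \<i>)\<inverse> = {(y, R y) | y. True}"
      using self_adjoint_resolvent by blast
    have ext: "(R f, f + \<i> *\<^sub>C R f) \<in> M" "q (R f) = U (p (R f))" for f
      using R unfolding resolvent_graph_iff ext_iff by blast+
    \<comment> \<open>Split \<open>R f\<close> into \<open>S f\<close> and a defect vector, which
      \<open>lower\<close> controls through \<open>U - V\<close> at \<open>p (R f)\<close>. Here
      \<open>\<phi>\<close> is the identity and \<open>\<psi>\<close> sends \<open>f\<close> to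
      \<open>p (R f)\<close>; the constant \<open>1 + 3 * C\<close> bounds both.\<close>
    have "compact_op R"
    proof (rule compact_op_dominated[OF R_lin S(1) UV])
      show "norm f \<le> (1 + 3 * C) * norm f" for f :: 'h
        using C(1) by (simp add: distrib_right)
      show "norm (p (R f)) \<le> (1 + 3 * C) * norm f" for f
      proof -
        have "norm (p (R f)) \<le> C * (norm (R f) + norm (f + \<i> *\<^sub>C R f))"
          using C(2)[OF ext(1)[of f]] norm_ge_zero[of "q (R f)"] by linarith
        also have "\<dots> \<le> C * (3 * norm f)"
          using C(1) R_le[of f] norm_triangle_ineq[of f "\<i> *\<^sub>C R f"]
          by (intro mult_left_mono) auto
        also have "\<dots> \<le> (1 + 3 * C) * norm f" by (simp add: distrib_right)
        finally show ?thesis .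
      qed
      show "norm (R f - R f') \<le> (1 + K) * (norm (S f - S f') +
          norm ((U (p (R f)) - V (p (R f))) - (U (p (R f')) - V (p (R f')))))" for f f'
      proof -
        let ?f = "f - f'"
        let ?d = "(U (p (R f)) - V (p (R f))) - (U (p (R f')) - V (p (R f')))"
        have pR: "p (R ?f) = p (R f) - p (R f')"
          using pq_diff(1)[OF ext(1) ext(1), of f f'] by (simp add: clinear_diff[OF R_lin])
        have "norm (R ?f - S ?f) \<le> K * norm (V (p (R ?f)) - q (R ?f))"
          using lower[OF defect(1)[OF ext(1)]] defect(2)[OF ext(1)] by simp
        also have "norm (V (p (R ?f)) - q (R ?f)) = norm ?d"
          unfolding ext(2) pR clinear_diff[OF U'(1)] clinear_diff[OF V'(1)]
          by (subst norm_minus_commute) (simp add: algebra_simps)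
        finally have "norm (R ?f) \<le> norm (S ?f) + K * norm ?d"
          using norm_triangle_ineq[of "R ?f - S ?f" "S ?f"] by simp
        also have "\<dots> \<le> (1 + K) * (norm (S ?f) + norm ?d)"
          using K by (simp add: algebra_simps)
        finally show ?thesis by (simp add: clinear_diff[OF R_lin] clinear_diff[OF S_lin])
      qed
    qed
    then show "compact_resolvent (ext U)" using R by (auto simp: compact_resolvent_def)
  qed
qed

end

section \<open>From boundary triplets to the Cayley form\<close>

lemma boundary_triplet_imp_cayley:
  fixes \<Gamma>\<^sub>0 \<Gamma>\<^sub>1 :: "'h::chilbert_space \<Rightarrow> 'g::chilbert_space"
  assumes dense: "densely_defined T" and sym: "symmetric_operator T"
    and bt: "boundary_triplet T \<Gamma>\<^sub>0 \<Gamma>\<^sub>1"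
  shows "cayley_boundary_triplet T (\<lambda>x. \<Gamma>\<^sub>1 x + \<i> *\<^sub>C \<Gamma>\<^sub>0 x) (\<lambda>x. \<Gamma>\<^sub>1 x - \<i> *\<^sub>C \<Gamma>\<^sub>0 x)"
proof
  have lin: "clinear_on (Domain (adjoint_op T)) \<Gamma>\<^sub>0" "clinear_on (Domain (adjoint_op T)) \<Gamma>\<^sub>1"
    and surj: "(\<lambda>x. (\<Gamma>\<^sub>0 x, \<Gamma>\<^sub>1 x)) ` Domain (adjoint_op T) = UNIV"
    and green: "\<And>x u y v. (x, u) \<in> adjoint_op T \<Longrightarrow> (y, v) \<in> adjoint_op T \<Longrightarrow>
      cinner u y - cinner x v = cinner (\<Gamma>\<^sub>1 x) (\<Gamma>\<^sub>0 y) - cinner (\<Gamma>\<^sub>0 x) (\<Gamma>\<^sub>1 y)"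
    using bt unfolding boundary_triplet_def by blast+
  show "clinear_on (Domain (adjoint_op T)) (\<lambda>x. \<Gamma>\<^sub>1 x + \<i> *\<^sub>C \<Gamma>\<^sub>0 x)"
    using lin by (auto simp: clinear_on_def scaleC_add_right scaleC_scaleC mult.commute)
  show "clinear_on (Domain (adjoint_op T)) (\<lambda>x. \<Gamma>\<^sub>1 x - \<i> *\<^sub>C \<Gamma>\<^sub>0 x)"
    using lin
    by (auto simp: clinear_on_def scaleC_add_right scaleC_diff_right scaleC_scaleC mult.commute)
  show "\<exists>x\<in>Domain (adjoint_op T). \<Gamma>\<^sub>1 x + \<i> *\<^sub>C \<Gamma>\<^sub>0 x = g \<and> \<Gamma>\<^sub>1 x - \<i> *\<^sub>C \<Gamma>\<^sub>0 x = h" for g h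
  proof -
    \<comment> \<open>These values invert the Cayley change of coordinates: half the sum of
      \<open>g\<close> and \<open>h\<close> for \<open>\<Gamma>\<^sub>1\<close>, their difference
      divided by \<open>2 * \<i>\<close> for \<open>\<Gamma>\<^sub>0\<close>.\<close>
    have "((1 / (2 * \<i>)) *\<^sub>C (g - h), (1 / 2) *\<^sub>C (g + h)) \<in> (\<lambda>x. (\<Gamma>\<^sub>0 x, \<Gamma>\<^sub>1 x)) ` Domain (adjoint_op T)"
      using surj by simp
    then obtain x where x: "x \<in> Domain (adjoint_op T)"
      "\<Gamma>\<^sub>0 x = (1 / (2 * \<i>)) *\<^sub>C (g - h)" "\<Gamma>\<^sub>1 x = (1 / 2) *\<^sub>C (g + h)"
      by (elim imageE) simp
    have "\<i> *\<^sub>C \<Gamma>\<^sub>0 x = (1 / 2) *\<^sub>C (g - h)" by (simp add: x scaleC_scaleC)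
    then have "\<Gamma>\<^sub>1 x + \<i> *\<^sub>C \<Gamma>\<^sub>0 x = (1 / 2 + 1 / 2) *\<^sub>C g" "\<Gamma>\<^sub>1 x - \<i> *\<^sub>C \<Gamma>\<^sub>0 x = (1 / 2 + 1 / 2) *\<^sub>C h"
      unfolding x(3) scaleC_add_left by (simp_all add: scaleC_add_right scaleC_diff_right)
    then show ?thesis using x(1) by (auto simp: scaleC_one)
  qed
  show "cinner u y - cinner x v = \<i> / 2 *
      (cinner (\<Gamma>\<^sub>1 x + \<i> *\<^sub>C \<Gamma>\<^sub>0 x) (\<Gamma>\<^sub>1 y + \<i> *\<^sub>C \<Gamma>\<^sub>0 y)
        - cinner (\<Gamma>\<^sub>1 x - \<i> *\<^sub>C \<Gamma>\<^sub>0 x) (\<Gamma>\<^sub>1 y - \<i> *\<^sub>C \<Gamma>\<^sub>0 y))"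
    if "(x, u) \<in> adjoint_op T" "(y, v) \<in> adjoint_op T" for x u y v
    unfolding green[OF that]
    by (simp add: cinner_add_left cinner_add_right cinner_diff_left cinner_diff_right
        cinner_scaleC_left cinner_scaleC_right field_simps)
qed (fact dense sym)+

theorem theorem1p2:
  fixes T :: "'h::chilbert_space operator"
    and \<Gamma>\<^sub>0 \<Gamma>\<^sub>1 :: "'h \<Rightarrow> 'g::chilbert_space"
  assumes "separable_space (euclidean :: 'h topology)"
    and "linear_operator T"
    and "densely_defined T"
    and "closed T"
    and "symmetric_operator T"
    and "equal_deficiency_indices T"
    and "boundary_triplet T \<Gamma>\<^sub>0 \<Gamma>\<^sub>1"
    and "compact_resolvent
      (restrict_op (adjoint_op T) {x \<in> Domain (adjoint_op T). \<Gamma>\<^sub>0 x = 0})"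
  shows "(\<forall>U. unitary_op U \<longrightarrow>
        (compact_resolvent (triplet_extension T \<Gamma>\<^sub>0 \<Gamma>\<^sub>1 U) \<longleftrightarrow> compact_op (\<lambda>g. U g - g)))
    \<and> bij_betw (triplet_extension T \<Gamma>\<^sub>0 \<Gamma>\<^sub>1)
        {U. unitary_op U \<and> compact_op (\<lambda>g. U g - g)}
        {A. self_adjoint_extension T A \<and> compact_resolvent A}"
proof -
  interpret cayley_boundary_triplet T "\<lambda>x. \<Gamma>\<^sub>1 x + \<i> *\<^sub>C \<Gamma>\<^sub>0 x" "\<lambda>x. \<Gamma>\<^sub>1 x - \<i> *\<^sub>C \<Gamma>\<^sub>0 x"
    using assms by (intro boundary_triplet_imp_cayley)
  have eq: "triplet_extension T \<Gamma>\<^sub>0 \<Gamma>\<^sub>1 U = ext U" if "unitary_op U" for U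
  proof -
    note U = unitary_opD(1)[OF that]
    have "\<Gamma>\<^sub>1 x - U (\<Gamma>\<^sub>1 x) = \<i> *\<^sub>C (\<Gamma>\<^sub>0 x + U (\<Gamma>\<^sub>0 x)) \<longleftrightarrow>
        \<Gamma>\<^sub>1 x - \<i> *\<^sub>C \<Gamma>\<^sub>0 x = U (\<Gamma>\<^sub>1 x + \<i> *\<^sub>C \<Gamma>\<^sub>0 x)" for x
      using U by (auto simp: clinear_iff scaleC_add_right algebra_simps)
    then show ?thesis
      by (auto simp: triplet_extension_def restrict_op_def ext_def)
  qed
  have id: "unitary_op (\<lambda>g :: 'g. g)" by (auto simp: unitary_op_def clinear_iff surj_def)
  have "\<Gamma>\<^sub>0 x = 0 \<longleftrightarrow> \<Gamma>\<^sub>1 x - \<i> *\<^sub>C \<Gamma>\<^sub>0 x = \<Gamma>\<^sub>1 x + \<i> *\<^sub>C \<Gamma>\<^sub>0 x" for x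
  proof
    assume "\<Gamma>\<^sub>1 x - \<i> *\<^sub>C \<Gamma>\<^sub>0 x = \<Gamma>\<^sub>1 x + \<i> *\<^sub>C \<Gamma>\<^sub>0 x"
    then have "\<i> *\<^sub>C \<Gamma>\<^sub>0 x + \<i> *\<^sub>C \<Gamma>\<^sub>0 x = 0" by (simp add: algebra_simps)
    then have "norm ((\<i> + \<i>) *\<^sub>C \<Gamma>\<^sub>0 x) = 0" by (simp only: scaleC_add_left norm_zero)
    then show "\<Gamma>\<^sub>0 x = 0" by (simp only: norm_scaleC) simp
  qed simp
  then have "restrict_op (adjoint_op T) {x \<in> Domain (adjoint_op T). \<Gamma>\<^sub>0 x = 0} = ext (\<lambda>g. g)"
    by (auto simp: restrict_op_def ext_def)
  \<comment> \<open>On the kernel of \<open>\<Gamma>\<^sub>0\<close> the two Cayley maps agree, so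
    the reference extension belongs to the identity, which takes the role of
    \<open>V\<close>.\<close>
  then have iff: "compact_resolvent (ext U) \<longleftrightarrow> compact_op (\<lambda>g. U g - g)" if "unitary_op U" for U
    using compact_resolvent_ext_iff[OF that id] assms(8) by simp
  have "bij_betw (triplet_extension T \<Gamma>\<^sub>0 \<Gamma>\<^sub>1)
      {U. unitary_op U \<and> compact_op (\<lambda>g. U g - g)}
      {A. self_adjoint_extension T A \<and> compact_resolvent A}"
  proof (rule bij_betw_imageI)
    show "inj_on (triplet_extension T \<Gamma>\<^sub>0 \<Gamma>\<^sub>1) {U. unitary_op U \<and> compact_op (\<lambda>g. U g - g)}"
      using ext_inject eq by (auto intro!: inj_onI)
    show "triplet_extension T \<Gamma>\<^sub>0 \<Gamma>\<^sub>1 ` {U. unitary_op U \<and> compact_op (\<lambda>g. U g - g)}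
        = {A. self_adjoint_extension T A \<and> compact_resolvent A}"
    proof (intro antisym subsetI)
      fix A assume "A \<in> triplet_extension T \<Gamma>\<^sub>0 \<Gamma>\<^sub>1 ` {U. unitary_op U \<and> compact_op (\<lambda>g. U g - g)}"
      then show "A \<in> {A. self_adjoint_extension T A \<and> compact_resolvent A}"
        using eq iff self_adjoint_extension_ext by auto
    next
      fix A assume A: "A \<in> {A. self_adjoint_extension T A \<and> compact_resolvent A}"
      then obtain U where U: "unitary_op U" "A = ext U"
        using self_adjoint_extension_imp_ext by blast
      then show "A \<in> triplet_extension T \<Gamma>\<^sub>0 \<Gamma>\<^sub>1 ` {U. unitary_op U \<and> compact_op (\<lambda>g. U g - g)}"
        using A eq iff by (intro image_eqI[of _ _ U]) auto
    qed
  qed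
  then show ?thesis using eq iff by simp
qed

end
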